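(* Consider the following problem of hitting growable balls. There is a ground set of $n$ vertices, $m$ balls $B_1,\dots,B_m$ (subsets of the ground set) which are initially empty, a parameter $r$ with $1\le r\le n$, and the cost function $f(x)=x^p$ for a constant $p\ge1$. An algorithm may repeatedly pick a ball that does not yet contain all vertices and ask an adversary to add one new vertex (chosen by the adversary) to it. At the end the algorithm must output a set of centers (vertices) such that every ball contains at least one center; the cost is $\sum_{i=1}^m f(|B_i|)$. Consider the following deterministic algorithm: set $b\gets\lceil 2^{p+2}n/r\rceil$ and grow every ball to size $\min\{b,n\}$; then, while some ball contains no selected center (is unhit), let $m'$ be the number of unhit balls, repeatedly select as a new center a vertex belonging to the largest number of unhit balls until at most $m'/2^{p+1}$ balls are unhit, then set $b\gets 2b$ and grow each unhit ball to size $\min\{b,n\}$; finally output all selected centers. Then this algorithm selects at most $r$ centers, they hit all the balls, the total cost is $O_p(m(n/r)^p)=O_p(m\cdot f(n/r))$, and the algorithm can be implemented in $O_p(r+mn/r)$ time (counting each grow request as unit time).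
   Context: $O_p(\cdot)$ means the hidden constant may depend on $p$. A ball is hit if it contains at least one selected center. *)

theory Defs
  imports Complex_Main
begin

text \<open>The ground set is \<open>{..<n}\<close> and the balls are indexed by \<open>{..<m}\<close>. An execution is
  recorded chronologically: \<open>Grow i v\<close> means that the algorithm asked for ball \<open>i\<close> to be grown and
  the adversary added \<open>v\<close>; \<open>Select c\<close> means that \<open>c\<close> became a center. The current balls and
  centers are read off from the history.\<close>

datatype event = Grow nat nat | Select nat

type_synonym history = "event list"

definition gball :: "history \<Rightarrow> nat \<Rightarrow> nat set" where
  "gball h i = {v. Grow i v \<in> set h}"

definition centers :: "history \<Rightarrow> nat set" where
  "centers h = {c. Select c \<in> set h}"

definition unhit :: "nat \<Rightarrow> history \<Rightarrow> nat set" where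
  "unhit m h = {i. i < m \<and> gball h i \<inter> centers h = {}}"

definition load :: "nat \<Rightarrow> history \<Rightarrow> nat \<Rightarrow> nat" where
  "load m h v = card {i \<in> unhit m h. v \<in> gball h i}"

definition cost_fun :: "real \<Rightarrow> real \<Rightarrow> real" where
  "cost_fun p x = x powr p"

definition total_cost :: "real \<Rightarrow> nat \<Rightarrow> history \<Rightarrow> real" where
  "total_cost p m h = (\<Sum>i<m. cost_fun p (real (card (gball h i))))"

text \<open>An adversary is adaptive: its answer to a request for ball \<open>i\<close> may depend on the whole
  history.\<close>

type_synonym adversary = "history \<Rightarrow> nat \<Rightarrow> nat"

definition valid_adversary :: "nat \<Rightarrow> nat \<Rightarrow> adversary \<Rightarrow> bool" where
  "valid_adversary n m adv \<longleftrightarrow>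
     (\<forall>h i. i < m \<and> \<not> {..<n} \<subseteq> gball h i \<longrightarrow> adv h i < n \<and> adv h i \<notin> gball h i)"


section \<open>The algorithm\<close>

text \<open>A configuration consists of the point of control, the current value of \<open>b\<close>, and the
  history. In \<open>Growing A\<close> the balls in \<open>A\<close> are being grown to size \<open>min b n\<close>; in \<open>Selecting k\<close>
  centers are being selected, where \<open>k\<close> is the number \<open>m'\<close> of balls that were unhit at the beginning
  of the current iteration of the while loop. The order of the grow requests and the choice
  among vertices lying in equally many unhit balls are left open, so every rule for them is covered.\<close>

datatype phase = Growing "nat set" | Selecting nat | Finished

type_synonym config = "phase \<times> nat \<times> history"

definition start_size :: "real \<Rightarrow> nat \<Rightarrow> real \<Rightarrow> nat" where
  "start_size p n r = nat \<lceil>2 powr (p + 2) * real n / r\<rceil>"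

definition init_config :: "real \<Rightarrow> nat \<Rightarrow> nat \<Rightarrow> real \<Rightarrow> config" where
  "init_config p n m r = (Growing {..<m}, start_size p n r, [])"

inductive alg_step :: "real \<Rightarrow> nat \<Rightarrow> nat \<Rightarrow> adversary \<Rightarrow> config \<Rightarrow> config \<Rightarrow> bool"
  for p n m adv where
  grow: "\<lbrakk>i \<in> A; card (gball h i) < min b n\<rbrakk> \<Longrightarrow>
    alg_step p n m adv (Growing A, b, h) (Growing A, b, h @ [Grow i (adv h i)])"
| enter_loop: "\<lbrakk>\<forall>i\<in>A. card (gball h i) \<ge> min b n; unhit m h \<noteq> {}\<rbrakk> \<Longrightarrow>
    alg_step p n m adv (Growing A, b, h) (Selecting (card (unhit m h)), b, h)"
| exit_loop: "\<lbrakk>\<forall>i\<in>A. card (gball h i) \<ge> min b n; unhit m h = {}\<rbrakk> \<Longrightarrow>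
    alg_step p n m adv (Growing A, b, h) (Finished, b, h)"
| select: "\<lbrakk>real (card (unhit m h)) > real k / 2 powr (p + 1);
            v < n; \<forall>w<n. load m h w \<le> load m h v\<rbrakk> \<Longrightarrow>
    alg_step p n m adv (Selecting k, b, h) (Selecting k, b, h @ [Select v])"
| double: "real (card (unhit m h)) \<le> real k / 2 powr (p + 1) \<Longrightarrow>
    alg_step p n m adv (Selecting k, b, h) (Growing (unhit m h), 2 * b, h)"


section \<open>Random access machine with grow requests\<close>

text \<open>Running time is measured on a uniform-cost RAM with addition and (truncated) subtraction but
  no multiplication, all of whose cells initially contain 0 except for those holding the input.
  The memory is divided into arrays of unbounded length; an array is named by a literal, so a program
  uses only finitely many of them, and interleaving them yields the usual single memory with
  constant overhead. A scalar variable is the cell 0 of an array.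

  As \<open>p\<close> and \<open>r\<close> are real, the two quantities of the algorithm that involve them cannot be
  computed by integer arithmetic; the machine has an operation for each of them:
  \<open>StartSize\<close> for the initial value of \<open>b\<close>, and \<open>Quota\<close>, which takes \<open>m'\<close> to the largest integer that
  is at most \<open>m' / 2\<^bsup>p+1\<^esup>\<close>.\<close>

datatype expr =
    Num nat
  | Cell nat expr
  | Add expr expr
  | Sub expr expr
  | StartSize
  | Quota expr

datatype test = Less expr expr | Equal expr expr | Neg test | Conj test test

text \<open>\<open>Assign a e e'\<close> writes the value of \<open>e'\<close> to position \<open>e\<close> of array \<open>a\<close>; \<open>Request a e e'\<close> asks the
  adversary to grow ball \<open>e'\<close> and writes the vertex added to position \<open>e\<close> of array \<open>a\<close>;
  \<open>Emit e\<close> outputs \<open>e\<close> as a center.\<close>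

datatype com =
    Skip
  | Assign nat expr expr
  | Request nat expr expr
  | Emit expr
  | Seq com com
  | Cond test com com
  | While test com

type_synonym memory = "nat \<Rightarrow> nat \<Rightarrow> nat"

definition store :: "memory \<Rightarrow> nat \<Rightarrow> nat \<Rightarrow> nat \<Rightarrow> memory" where
  "store s a k x = s(a := (s a)(k := x))"

fun eval :: "real \<Rightarrow> nat \<Rightarrow> real \<Rightarrow> memory \<Rightarrow> expr \<Rightarrow> nat" where
  "eval p n r s (Num k) = k"
| "eval p n r s (Cell a e) = s a (eval p n r s e)"
| "eval p n r s (Add e e') = eval p n r s e + eval p n r s e'"
| "eval p n r s (Sub e e') = eval p n r s e - eval p n r s e'"
| "eval p n r s StartSize = start_size p n r"
| "eval p n r s (Quota e) = nat \<lfloor>real (eval p n r s e) / 2 powr (p + 1)\<rfloor>"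

fun holds :: "real \<Rightarrow> nat \<Rightarrow> real \<Rightarrow> memory \<Rightarrow> test \<Rightarrow> bool" where
  "holds p n r s (Less e e') \<longleftrightarrow> eval p n r s e < eval p n r s e'"
| "holds p n r s (Equal e e') \<longleftrightarrow> eval p n r s e = eval p n r s e'"
| "holds p n r s (Neg t) \<longleftrightarrow> \<not> holds p n r s t"
| "holds p n r s (Conj t t') \<longleftrightarrow> holds p n r s t \<and> holds p n r s t'"

text \<open>\<open>exec p n r adv c (s, h) T (s', h')\<close>: started in memory \<open>s\<close> after history \<open>h\<close>, the program \<open>c\<close>
  terminates after \<open>T\<close> units of time. Every elementary command, in particular every grow
  request, and every evaluation of a test takes one unit; a fixed program contains only
  expressions of bounded size, so charging for their subexpressions would only change the
  constant. The semantics is deterministic.\<close>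

inductive exec :: "real \<Rightarrow> nat \<Rightarrow> real \<Rightarrow> adversary \<Rightarrow> com \<Rightarrow>
    memory \<times> history \<Rightarrow> nat \<Rightarrow> memory \<times> history \<Rightarrow> bool"
  for p n r adv where
  Skip: "exec p n r adv Skip (s, h) 1 (s, h)"
| Assign: "exec p n r adv (Assign a e e') (s, h) 1
    (store s a (eval p n r s e) (eval p n r s e'), h)"
| Request: "\<lbrakk>i = eval p n r s e'; v = adv h i\<rbrakk> \<Longrightarrow>
    exec p n r adv (Request a e e') (s, h) 1 (store s a (eval p n r s e) v, h @ [Grow i v])"
| Emit: "exec p n r adv (Emit e) (s, h) 1 (s, h @ [Select (eval p n r s e)])"
| Seq: "\<lbrakk>exec p n r adv c x T y; exec p n r adv c' y T' z\<rbrakk> \<Longrightarrow>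
    exec p n r adv (Seq c c') x (T + T') z"
| Cond_true: "\<lbrakk>holds p n r s t; exec p n r adv c (s, h) T y\<rbrakk> \<Longrightarrow>
    exec p n r adv (Cond t c c') (s, h) (T + 1) y"
| Cond_false: "\<lbrakk>\<not> holds p n r s t; exec p n r adv c' (s, h) T y\<rbrakk> \<Longrightarrow>
    exec p n r adv (Cond t c c') (s, h) (T + 1) y"
| While_false: "\<not> holds p n r s t \<Longrightarrow> exec p n r adv (While t c) (s, h) 1 (s, h)"
| While_true: "\<lbrakk>holds p n r s t; exec p n r adv c (s, h) T y;
    exec p n r adv (While t c) y T' z\<rbrakk> \<Longrightarrow>
    exec p n r adv (While t c) (s, h) (T + T' + 1) z"

definition input_memory :: "nat \<Rightarrow> nat \<Rightarrow> memory" where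
  "input_memory n m = store (store (\<lambda>_ _. 0) 0 0 n) 1 0 m"

end

theory Submission
  imports Defs
begin

text \<open>A vertex of maximal load lies in at least the average number of unhit balls, so while more than
  \<open>m' / 2\<^bsup>p+1\<^esup>\<close> balls of size \<open>b\<close> are unhit, every selection hits more than
  \<open>m' b / (2\<^bsup>p+1\<^esup> n)\<close> of them, and the phase selects fewer than \<open>2\<^bsup>p+1\<^esup> n / b\<close> centers. As \<open>b\<close>
  doubles, these numbers form a geometric series bounded by \<open>r\<close>. The number of unhit balls shrinks by
  \<open>2\<^bsup>p+1\<^esup>\<close> per phase whereas the cost of a ball grows by \<open>2\<^sup>p\<close>, so the costs of the phases form a
  geometric series with ratio \<open>1/2\<close>; with exponent 1 the same argument bounds the number of grow
  requests by \<open>O(m n / r)\<close>.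

  For the running time it remains to spend amortized constant time per grow request. Each request
  creates a node that is linked into the list of its ball, the list of its vertex, and the bucket
  of the load that the vertex has just reached. Hence a vertex of load \<open>d\<close> occurs in all
  buckets \<open>1, \<dots>, d\<close>, a decreasing load requires no update of the buckets, and a vertex of maximal load is
  found by discarding outdated entries from the top bucket downwards. Each node is discarded at most
  once, traversed at most once when its vertex is selected, and at most once when its ball is hit.\<close>

section \<open>Centers, cost and termination\<close>

text \<open>The adversary may answer with a vertex that is already a center, so balls can become hit
  while they grow. Hence a growing phase remembers its set \<open>A\<close>, and only
  \<open>unhit m h \<subseteq> A\<close> is maintained. The factor \<open>2 powr (p + 2)\<close> in
  \<open>start_size\<close> makes the initial reserve at most \<open>r\<close>. The counting of
  centers per phase needs balls of size \<open>b\<close>, but balls stop at \<open>n\<close>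
  vertices. A phase with \<open>b \<ge> n\<close> is therefore treated apart: its unhit balls are
  the whole ground set and one center ends it. No sum over phases is ever formed. Each geometric
  series becomes an invariant of the current configuration: \<open>card A * b powr (q + 1)\<close>
  never exceeds its initial value, and the cost spent so far is bounded by a partial sum in closed
  form. The program has no specification of its own. Every statement about it carries reachability
  of an abstract configuration, so its run is one of the runs of \<open>alg_step\<close>, with order
  and ties resolved. The number of requests is then bounded by the invariant for exponent 1, and
  only the time per request needs a new argument.\<close>

lemma gball_simps [simp]:
  "gball [] i = {}"
  "gball (h @ [Grow j v]) i = (if i = j then insert v (gball h i) else gball h i)"
  "gball (h @ [Select c]) i = gball h i"
  by (auto simp: gball_def)

lemma centers_simps [simp]:
  "centers [] = {}"
  "centers (h @ [Grow j v]) = centers h"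
  "centers (h @ [Select c]) = insert c (centers h)"
  by (auto simp: centers_def)

lemma finite_gball [simp]: "finite (gball h i)"
proof -
  have "gball h i \<subseteq> (\<lambda>e. case e of Grow _ v \<Rightarrow> v | _ \<Rightarrow> 0) ` set h"
    by (force simp: gball_def)
  then show ?thesis by (rule finite_subset) simp
qed

lemma finite_centers [simp]: "finite (centers h)"
proof -
  have "centers h \<subseteq> (\<lambda>e. case e of Select v \<Rightarrow> v | _ \<Rightarrow> 0) ` set h"
    by (force simp: centers_def)
  then show ?thesis by (rule finite_subset) simp
qed

lemma finite_unhit [simp]: "finite (unhit m h)"
  by (simp add: unhit_def)

lemma unhit_subset: "unhit m h \<subseteq> {..<m}"
  by (auto simp: unhit_def)

section \<open>Unhit balls after an event, and double counting of loads\<close>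

lemma unhit_Grow: "unhit m (h @ [Grow i v]) \<subseteq> unhit m h"
  by (auto simp: unhit_def split: if_splits)

lemma unhit_Select: "unhit m (h @ [Select v]) = unhit m h - {i. v \<in> gball h i}"
  by (auto simp: unhit_def)

lemma card_unhit_Select: "card (unhit m (h @ [Select v])) + load m h v = card (unhit m h)"
proof -
  have "unhit m h = unhit m (h @ [Select v]) \<union> {i \<in> unhit m h. v \<in> gball h i}"
    by (auto simp: unhit_Select)
  also have "card \<dots> = card (unhit m (h @ [Select v])) + load m h v"
    unfolding load_def by (rule card_Un_disjoint) (auto simp: unhit_Select)
  finally show ?thesis by simp
qed

text \<open>Double counting of the incidences between vertices and unhit balls.\<close>

lemma sum_load:
  assumes "\<And>i. i \<in> unhit m h \<Longrightarrow> gball h i \<subseteq> {..<n}"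
  shows "(\<Sum>v<n. load m h v) = (\<Sum>i\<in>unhit m h. card (gball h i))"
proof -
  have "(\<Sum>v<n. load m h v) = (\<Sum>v<n. \<Sum>i\<in>unhit m h. if v \<in> gball h i then 1 else 0)"
    unfolding load_def by (simp add: sum.If_cases Int_def)
  also have "\<dots> = (\<Sum>i\<in>unhit m h. \<Sum>v<n. if v \<in> gball h i then 1 else 0)"
    by (rule sum.swap)
  also have "\<dots> = (\<Sum>i\<in>unhit m h. card (gball h i))"
  proof (rule sum.cong)
    fix i assume "i \<in> unhit m h"
    then have "{..<n} \<inter> gball h i = gball h i" using assms by auto
    then show "(\<Sum>v<n. if v \<in> gball h i then 1 else 0) = card (gball h i)"
      by (simp add: sum.If_cases Int_def)
  qed simp
  finally show ?thesis .
qed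

text \<open>The maximum is at least the average, written without division. The size \<open>s\<close>
  is \<open>b\<close> when centers are charged and \<open>min b n\<close> when only progress is
  needed.\<close>

lemma max_load_ge:
  assumes "\<And>i. i \<in> unhit m h \<Longrightarrow> gball h i \<subseteq> {..<n}"
    and "\<And>i. i \<in> unhit m h \<Longrightarrow> s \<le> card (gball h i)"
    and "\<forall>w<n. load m h w \<le> load m h v"
  shows "card (unhit m h) * s \<le> n * load m h v"
proof -
  have "card (unhit m h) * s \<le> (\<Sum>i\<in>unhit m h. card (gball h i))"
    using sum_mono[of "unhit m h" "\<lambda>_. s"] assms(2) by simp
  also have "\<dots> = (\<Sum>v<n. load m h v)" using sum_load assms(1) by metis
  also have "\<dots> \<le> n * load m h v"
    using sum_mono[of "{..<n}" "load m h" "\<lambda>_. load m h v"] assms(3) by simp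
  finally show ?thesis .
qed

definition ball_cost :: "real \<Rightarrow> history \<Rightarrow> nat \<Rightarrow> real" where
  "ball_cost q h i = real (card (gball h i)) powr q"

lemma ball_cost_nonneg: "ball_cost q h i \<ge> 0"
  by (simp add: ball_cost_def)

locale hitting =
  fixes p :: real and n m :: nat and r :: real and adv :: adversary
  assumes p_ge_1: "1 \<le> p" and r_ge_1: "1 \<le> r" and r_le_n: "r \<le> real n"
    and adv: "valid_adversary n m adv"
begin

abbreviation b0 :: nat where "b0 \<equiv> start_size p n r"

lemma n_pos: "0 < n"
  using r_ge_1 r_le_n by (cases n) auto

lemma b0_ge: "2 powr (p + 2) * real n / r \<le> real b0"
  unfolding start_size_def by linarith

lemma b0_pos: "0 < b0"
proof -
  have "0 < 2 powr (p + 2) * real n / r" using n_pos r_ge_1 by simp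
  then show ?thesis using b0_ge by linarith
qed

text \<open>Rounding up loses at most 1, and \<open>1 \<le> n / r\<close> absorbs it.\<close>

lemma b0_le: "real b0 \<le> (2 powr (p + 2) + 1) * (real n / r)"
proof -
  have "real b0 \<le> 2 powr (p + 2) * real n / r + 1"
  proof -
    have "0 \<le> 2 powr (p + 2) * real n / r" using r_ge_1 by simp
    then show ?thesis unfolding start_size_def by linarith
  qed
  also have "1 \<le> real n / r" using r_le_n r_ge_1 by simp
  finally show ?thesis by (simp add: algebra_simps)
qed

lemma adv_new:
  assumes "i < m" "gball h i \<subseteq> {..<n}" "card (gball h i) < n"
  shows "adv h i < n" "adv h i \<notin> gball h i"
proof -
  have "\<not> {..<n} \<subseteq> gball h i"
    using assms(3) card_mono[OF finite_gball, of "{..<n}" h i] by auto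
  then show "adv h i < n" "adv h i \<notin> gball h i"
    using adv assms(1) by (auto simp: valid_adversary_def)
qed

section \<open>Invariants of configurations\<close>

definition wf_hist :: "history \<Rightarrow> bool" where
  "wf_hist h \<longleftrightarrow> (\<forall>i. gball h i \<subseteq> {..<n}) \<and> (\<forall>i\<ge>m. gball h i = {}) \<and> centers h \<subseteq> {..<n}"

text \<open>A phase with parameter \<open>b < n\<close> selects at most \<open>2\<^bsup>p+1\<^esup> n / b\<close> centers, so half of the reserve
  \<open>2\<^bsup>p+2\<^esup> n / b\<close> pays for it and the other half is the reserve of the next phase. As soon as
  \<open>b \<ge> n\<close> a single further center suffices. The costs are controlled for every exponent \<open>q \<le> p\<close>:
  \<open>q = p\<close> is the objective and \<open>q = 1\<close> counts the grow requests.\<close>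

definition reserve :: "nat \<Rightarrow> history \<Rightarrow> bool" where
  "reserve b h \<longleftrightarrow> real (card (centers h)) + 2 powr (p + 2) * n / b \<le> r
     \<and> (b = b0 \<and> centers h = {} \<or> b < 2 * n)"

text \<open>For \<open>b < n\<close> the last summand is a refund: the fraction of the
  \<open>k\<close> balls hit so far, times the allowance \<open>2 powr (p + 1) * n / b\<close> of
  the phase. Each selection raises it by at least 1, and it never exceeds the allowance. For
  \<open>b \<ge> n\<close> the first selection hits everything, so having still \<open>k\<close>
  unhit balls means that none was made in this phase.\<close>

definition reserve_select :: "nat \<Rightarrow> nat \<Rightarrow> history \<Rightarrow> bool" where
  "reserve_select k b h \<longleftrightarrow>
     (if b < n then real (card (centers h)) + 2 powr (p + 2) * n / b
        \<le> r + (real k - real (card (unhit m h))) / k * (2 powr (p + 1) * n / b)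
      else card (unhit m h) = k \<and> real (card (centers h)) + 1 \<le> r)"

definition done_hist :: "history \<Rightarrow> bool" where
  "done_hist h \<longleftrightarrow> unhit m h = {} \<and> real (card (centers h)) \<le> r"

text \<open>From one phase to the next the number of balls shrinks by \<open>2 powr (p + 1)\<close>
  and the weight \<open>b powr (q + 1)\<close> grows by \<open>2 powr (q + 1)\<close>. Dividing the
  bound on their product by \<open>b\<close> bounds the cost of the balls grown to size
  \<open>b\<close>. The sum of \<open>1 / c\<close> over \<open>c = b0, 2 * b0, ...\<close> is
  \<open>2 / b0 - 2 / b\<close> before \<open>c = b\<close> is added and
  \<open>2 / b0 - 1 / b\<close> afterwards, which are the two factors below. The alternative
  \<open>done_hist\<close> takes over after a phase with \<open>b \<ge> n\<close>, where the reserve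
  is not carried on.\<close>

fun config_inv :: "real \<Rightarrow> config \<Rightarrow> bool" where
  "config_inv q (Growing A, b, h) \<longleftrightarrow> b0 \<le> b \<and> wf_hist h \<and> A \<subseteq> {..<m} \<and> unhit m h \<subseteq> A \<and>
     (\<forall>i\<in>A. card (gball h i) \<le> b) \<and> (done_hist h \<or> reserve b h) \<and>
     real (card A) * b powr (q + 1) \<le> m * b0 powr (q + 1) \<and>
     (\<Sum>i\<in>{..<m} - A. ball_cost q h i) \<le> m * b0 powr (q + 1) * (2 / b0 - 2 / b)"
| "config_inv q (Selecting k, b, h) \<longleftrightarrow> b0 \<le> b \<and> wf_hist h \<and> 0 < k \<and> card (unhit m h) \<le> k \<and>
     (\<forall>i\<in>unhit m h. card (gball h i) = min b n) \<and> (done_hist h \<or> reserve_select k b h) \<and>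
     real k * b powr (q + 1) \<le> m * b0 powr (q + 1) \<and>
     (\<Sum>i<m. ball_cost q h i) \<le> m * b0 powr (q + 1) * (2 / b0 - 1 / b)"
| "config_inv q (Finished, b, h) \<longleftrightarrow> wf_hist h \<and> done_hist h \<and>
     (\<Sum>i<m. ball_cost q h i) \<le> 2 * m * b0 powr q"

lemma wf_hist_Grow:
  assumes "wf_hist h" "i < m" "card (gball h i) < n"
  shows "wf_hist (h @ [Grow i (adv h i)])"
  using assms adv_new[of i h] by (auto simp: wf_hist_def)

lemma inv_init: "config_inv q (init_config p n m r)"
proof -
  have "2 powr (p + 2) * real n / b0 \<le> r"
    using b0_ge b0_pos r_ge_1 by (simp add: field_simps)
  then show ?thesis
    using unhit_subset
    by (auto simp: init_config_def wf_hist_def reserve_def)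
qed

lemma done_hist_Grow: "done_hist h \<Longrightarrow> done_hist (h @ [Grow i v])"
  using unhit_Grow[of m h i v] by (auto simp: done_hist_def)

lemma inv_grow:
  assumes "config_inv q (Growing A, b, h)" "i \<in> A" "card (gball h i) < min b n"
  shows "config_inv q (Growing A, b, h @ [Grow i (adv h i)])"
proof -
  let ?h = "h @ [Grow i (adv h i)]"
  have i: "i < m" and n: "card (gball h i) < n" and wf: "wf_hist h" using assms by auto
  have "unhit m ?h \<subseteq> A" using assms(1) unhit_Grow[of m h i "adv h i"] by auto
  moreover have "card (gball ?h j) \<le> b" if "j \<in> A" for j
    using assms that by (auto simp: card_insert_if)
  moreover have "(\<Sum>j\<in>{..<m} - A. ball_cost q ?h j) = (\<Sum>j\<in>{..<m} - A. ball_cost q h j)"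
    using assms(2) by (intro sum.cong) (auto simp: ball_cost_def)
  moreover have "done_hist ?h \<or> reserve b ?h"
    using assms(1) done_hist_Grow by (auto simp: reserve_def)
  ultimately show ?thesis
    using assms(1) wf_hist_Grow[OF wf i n] by auto
qed

text \<open>Adds the cost of \<open>A\<close>, at most \<open>card A * b powr q\<close>, to that of
  the other balls; adding \<open>1 / b\<close> turns \<open>2 / b0 - 2 / b\<close> into
  \<open>2 / b0 - 1 / b\<close>.\<close>

lemma sum_cost_grown:
  assumes "config_inv q (Growing A, b, h)" "0 \<le> q"
  shows "(\<Sum>i<m. ball_cost q h i) \<le> m * b0 powr (q + 1) * (2 / b0 - 1 / b)"
proof -
  have A: "A \<subseteq> {..<m}" and b: "0 < b" using assms(1) b0_pos by auto
  have "(\<Sum>i<m. ball_cost q h i)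
      = (\<Sum>i\<in>{..<m} - A. ball_cost q h i) + (\<Sum>i\<in>A. ball_cost q h i)"
    using A by (intro sum.subset_diff) auto
  also have "(\<Sum>i\<in>A. ball_cost q h i) \<le> (\<Sum>i\<in>A. b powr q)"
    using assms by (intro sum_mono) (auto simp: ball_cost_def intro!: powr_mono2)
  also have "\<dots> = real (card A) * b powr (q + 1) / b"
    using b by (simp add: powr_add)
  also have "\<dots> \<le> m * b0 powr (q + 1) / b"
    using assms(1) b by (intro divide_right_mono) auto
  finally have "(\<Sum>i<m. ball_cost q h i)
      \<le> (\<Sum>i\<in>{..<m} - A. ball_cost q h i) + m * b0 powr (q + 1) / b" by simp
  moreover have "(\<Sum>i\<in>{..<m} - A. ball_cost q h i) \<le> m * b0 powr (q + 1) * (2 / b0 - 2 / b)"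
    using assms(1) by simp
  moreover have "x * (2 / c - 2 / d) + x / d = x * (2 / c - 1 / d)" for x c d :: real
    by (simp add: right_diff_distrib diff_divide_distrib)
  ultimately show ?thesis by (smt (verit))
qed

lemma inv_enter_loop:
  assumes "config_inv q (Growing A, b, h)" "0 \<le> q" "\<forall>i\<in>A. min b n \<le> card (gball h i)" "unhit m h \<noteq> {}"
  shows "config_inv q (Selecting (card (unhit m h)), b, h)"
proof -
  let ?k = "card (unhit m h)"
  have wf: "wf_hist h" and b: "0 < b" and sub: "unhit m h \<subseteq> A" "A \<subseteq> {..<m}"
    using assms(1) b0_pos by auto
  have "card (gball h i) \<le> n" for i
    using wf card_mono[of "{..<n}" "gball h i"] by (auto simp: wf_hist_def)
  then have sz: "\<forall>i\<in>unhit m h. card (gball h i) = min b n"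
    using assms(1,3) sub by (fastforce intro: antisym)
  have "?k \<le> card A" using sub by (meson card_mono finite_lessThan finite_subset)
  then have "real ?k * b powr (q + 1) \<le> real (card A) * b powr (q + 1)"
    by (intro mult_right_mono) auto
  then have k: "real ?k * b powr (q + 1) \<le> m * b0 powr (q + 1)"
    using assms(1) by auto
  have res: "reserve b h" using assms(1,4) by (auto simp: done_hist_def)
  \<comment> \<open>The one center that a phase with full balls may select. In the initial phase,
    rounding up \<open>b0\<close> can push the reserve term below 1, but then no center exists yet
    and \<open>r \<ge> 1\<close> suffices. Later phases have \<open>b < 2 * n\<close>, so the
    reserve term is at least 1.\<close>
  have "real (card (centers h)) + 1 \<le> r" if "\<not> b < n"
  proof (cases "b = b0 \<and> centers h = {}")
    case True then show ?thesis using r_ge_1 by simp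
  next
    case False
    then have "b < 2 * n" using res by (auto simp: reserve_def)
    then have "1 \<le> 2 * real n / b" using b by simp
    also have "\<dots> \<le> 2 powr (p + 2) * n / b"
      using p_ge_1 powr_mono[of 1 "p + 2" 2] by (intro divide_right_mono mult_right_mono) auto
    finally show ?thesis using res by (auto simp: reserve_def)
  qed
  then have "reserve_select ?k b h"
    using res by (auto simp: reserve_select_def reserve_def)
  then show ?thesis
    using assms(1,4) k sz wf sum_cost_grown[OF assms(1,2)] by (auto simp: card_gt_0_iff)
qed

lemma inv_exit_loop:
  assumes "config_inv q (Growing A, b, h)" "0 \<le> q" "unhit m h = {}"
  shows "config_inv q (Finished, b, h)"
proof -
  have b: "0 < b" using assms(1) b0_pos by auto
  have "real m * b0 powr (q + 1) * (2 / b0 - 1 / b) \<le> m * b0 powr (q + 1) * (2 / b0)"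
    by (intro mult_left_mono) auto
  also have "\<dots> = 2 * m * b0 powr q" using b0_pos by (simp add: powr_add)
  finally have "(\<Sum>i<m. ball_cost q h i) \<le> 2 * m * b0 powr q"
    using sum_cost_grown[OF assms(1,2)] by linarith
  moreover have "0 \<le> 2 powr (p + 2) * n / b" by simp
  then have "done_hist h"
    using assms(1,3) unfolding config_inv.simps done_hist_def reserve_def by linarith
  ultimately show ?thesis using assms(1) by auto
qed

text \<open>Every selection makes progress, because unhit balls are nonempty at this stage. Both
  termination and the search for a top bucket rest on it.\<close>

lemma load_pos:
  assumes "config_inv q (Selecting k, b, h)" "unhit m h \<noteq> {}" "\<forall>w<n. load m h w \<le> load m h v"
  shows "0 < load m h v"
proof -
  have "card (unhit m h) * min b n \<le> n * load m h v"
    using assms by (intro max_load_ge) (auto simp: wf_hist_def)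
  moreover have "0 < card (unhit m h) * min b n"
    using assms n_pos b0_pos by (auto simp: card_gt_0_iff)
  ultimately show ?thesis by (metis gr0I mult_0_right not_le)
qed

lemma inv_select:
  assumes I: "config_inv q (Selecting k, b, h)" and u: "real (card (unhit m h)) > real k / 2 powr (p + 1)"
    and v: "v < n" and max: "\<forall>w<n. load m h w \<le> load m h v"
  shows "config_inv q (Selecting k, b, h @ [Select v])"
proof -
  let ?h = "h @ [Select v]"
  have wf: "wf_hist h" and b: "0 < b" and k: "0 < k" using I b0_pos by auto
  have ne: "unhit m h \<noteq> {}" using u
    by (metis card.empty divide_nonneg_nonneg not_le of_nat_0 of_nat_0_le_iff powr_ge_zero)
  have sub: "unhit m ?h \<subseteq> unhit m h" by (auto simp: unhit_Select)
  have cu: "card (unhit m ?h) + load m h v = card (unhit m h)" by (rule card_unhit_Select)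
  have cc: "real (card (centers ?h)) \<le> real (card (centers h)) + 1"
    by (simp add: card_insert_if)
  have res: "reserve_select k b h" using I ne by (auto simp: done_hist_def)
  have "done_hist ?h \<or> reserve_select k b ?h"
  proof (cases "b < n")
    case True
    have "card (unhit m h) * b \<le> n * load m h v"
      using I max True by (intro max_load_ge) (auto simp: wf_hist_def)
    then have "real (card (unhit m h)) * b \<le> n * real (load m h v)"
      by (metis of_nat_le_iff of_nat_mult)
    then have "real k / 2 powr (p + 1) * b \<le> n * real (load m h v)"
      using mult_right_mono[OF less_imp_le[OF u], of b] by simp
    \<comment> \<open>The right-hand side is the increase of the refund in
      \<open>reserve_select\<close>; it pays for the new center.\<close>
    then have "1 \<le> real (load m h v) / k * (2 powr (p + 1) * n / b)"
      using b k by (simp add: field_simps)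
    moreover have "real (card (unhit m ?h)) = real (card (unhit m h)) - real (load m h v)"
      using cu by linarith
    then have "(real k - real (card (unhit m ?h))) / k * (2 powr (p + 1) * n / b)
        = (real k - real (card (unhit m h))) / k * (2 powr (p + 1) * n / b)
          + real (load m h v) / k * (2 powr (p + 1) * n / b)"
      by (simp only: add_divide_distrib[symmetric] distrib_right[symmetric]) (simp add: algebra_simps)
    ultimately show ?thesis
      using res True cc unfolding reserve_select_def by simp
  next
    case False
    have "gball h i = {..<n}" if "i \<in> unhit m h" for i
      using I that False by (intro card_subset_eq) (auto simp: wf_hist_def)
    then have "unhit m ?h = {}" using v by (auto simp: unhit_Select)
    moreover have "real (card (centers ?h)) \<le> r"
      using cc res False by (auto simp: reserve_select_def)
    ultimately show ?thesis by (simp add: done_hist_def)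
  qed
  then show ?thesis
    using I wf v sub cu by (auto simp: wf_hist_def ball_cost_def)
qed

lemma inv_double:
  assumes I: "config_inv q (Selecting k, b, h)" and q: "0 \<le> q" "q \<le> p"
    and u: "real (card (unhit m h)) \<le> real k / 2 powr (p + 1)"
  shows "config_inv q (Growing (unhit m h), 2 * b, h)"
proof -
  have b: "0 < b" and k: "0 < k" using I b0_pos by auto
  have two: "1 < 2 powr (p + 1)" using powr_less_mono[of 0 "p + 1" 2] p_ge_1 by simp
  \<comment> \<open>Strictness contradicts \<open>reserve_select\<close> when
    \<open>b \<ge> n\<close>, so after a phase with full balls only \<open>done_hist\<close> is
    left.\<close>
  have lt: "card (unhit m h) < k"
  proof -
    have "real k / 2 powr (p + 1) < k" using two k by (simp add: field_simps)
    then show ?thesis using u by linarith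
  qed
  have "real (card (unhit m h)) * (2 * b) powr (q + 1)
      \<le> real k / 2 powr (p + 1) * (2 * b) powr (q + 1)"
    using u by (intro mult_right_mono) auto
  also have "\<dots> = real k * b powr (q + 1) * (2 powr (q + 1) / 2 powr (p + 1))"
    by (simp add: powr_mult)
  \<comment> \<open>Here \<open>q \<le> p\<close> enters: the loss of balls outweighs the gain in
    weight.\<close>
  also have "\<dots> \<le> real k * b powr (q + 1) * 1"
    using q by (intro mult_left_mono) auto
  finally have cu: "real (card (unhit m h)) * real (2 * b) powr (q + 1) \<le> m * b0 powr (q + 1)"
    using I by simp
  have "(\<Sum>i\<in>{..<m} - unhit m h. ball_cost q h i) \<le> (\<Sum>i<m. ball_cost q h i)"
    by (intro sum_mono2) (auto simp: ball_cost_nonneg)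
  then have cost: "(\<Sum>i\<in>{..<m} - unhit m h. ball_cost q h i)
      \<le> m * b0 powr (q + 1) * (2 / b0 - 2 / real (2 * b))"
    using I b by simp
  have "reserve (2 * b) h" if "reserve_select k b h"
  proof (cases "b < n")
    case True
    have "(real k - real (card (unhit m h))) / k * (2 powr (p + 1) * n / b)
        \<le> 1 * (2 powr (p + 1) * n / b)"
      using k by (intro mult_right_mono) auto
    then have "real (card (centers h)) + 2 powr (p + 2) * n / b \<le> r + 2 powr (p + 1) * n / b"
      using that True by (simp add: reserve_select_def)
    moreover have "2 powr (p + 2) = 2 * 2 powr (p + 1)"
      by (simp add: powr_add)
    ultimately show ?thesis using True by (simp add: reserve_def)
  next
    case False then show ?thesis using that lt by (simp add: reserve_select_def)
  qed
  then show ?thesis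
    using I cu cost unhit_subset by auto
qed

lemma inv_step:
  assumes "alg_step p n m adv c c'" "config_inv q c" "0 \<le> q" "q \<le> p"
  shows "config_inv q c'"
  using assms
proof cases
  case grow then show ?thesis using assms inv_grow by blast
next
  case enter_loop then show ?thesis using assms inv_enter_loop by blast
next
  case exit_loop then show ?thesis using assms inv_exit_loop by blast
next
  case select then show ?thesis using assms inv_select by blast
next
  case double then show ?thesis using assms inv_double by blast
qed

section \<open>Reachable configurations and termination\<close>

abbreviation reach :: "config \<Rightarrow> bool" where
  "reach \<equiv> (alg_step p n m adv)\<^sup>*\<^sup>* (init_config p n m r)"

lemma reach_inv: "reach c \<Longrightarrow> 0 \<le> q \<Longrightarrow> q \<le> p \<Longrightarrow> config_inv q c"
  by (induction rule: rtranclp_induct) (use inv_init inv_step in auto)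

fun rank :: "config \<Rightarrow> nat" where
  "rank (Growing A, b, h) = 2"
| "rank (Selecting k, b, h) = (if card (unhit m h) = k then 1 else 3)"
| "rank (Finished, b, h) = 0"

definition todo :: "history \<Rightarrow> nat" where
  "todo h = card (unhit m h) + (\<Sum>i<m. n - card (gball h i))"

definition variant :: "config \<Rightarrow> nat" where
  "variant c = 4 * todo (snd (snd c)) + rank c"

lemma todo_Grow:
  assumes "wf_hist h" "i < m" "card (gball h i) < n"
  shows "todo (h @ [Grow i (adv h i)]) < todo h"
proof -
  let ?h = "h @ [Grow i (adv h i)]"
  have "adv h i \<notin> gball h i" using assms adv_new by (auto simp: wf_hist_def)
  then have "(\<Sum>j<m. n - card (gball ?h j)) < (\<Sum>j<m. n - card (gball h j))"
    using assms by (intro sum_strict_mono_ex1) auto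
  moreover have "card (unhit m ?h) \<le> card (unhit m h)"
    by (intro card_mono unhit_Grow) simp
  ultimately show ?thesis by (simp add: todo_def)
qed

lemma variant_step:
  assumes "alg_step p n m adv c c'" "config_inv p c"
  shows "variant c' < variant c"
  using assms
proof cases
  case (grow i A h b)
  then have "todo (h @ [Grow i (adv h i)]) < todo h"
    using assms(2) by (intro todo_Grow) auto
  then show ?thesis using grow by (simp add: variant_def)
next
  case (select h k v b)
  have "unhit m h \<noteq> {}" using select(3)
    by (metis card.empty divide_nonneg_nonneg not_le of_nat_0 of_nat_0_le_iff powr_ge_zero)
  then have "0 < load m h v" using assms(2) select load_pos by blast
  then have "todo (h @ [Select v]) < todo h"
    using card_unhit_Select[of m h v] by (simp add: todo_def)
  then show ?thesis using select by (simp add: variant_def)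
next
  case (double h k b)
  have k: "0 < k" using assms(2) double by auto
  \<comment> \<open>The quota is below \<open>k\<close>, so doubling occurs only after some ball was
    hit, that is, at rank 3.\<close>
  have "1 < 2 powr (p + 1)" using powr_less_mono[of 0 "p + 1" 2] p_ge_1 by simp
  then have "real k / 2 powr (p + 1) < k" using k by (simp add: field_simps)
  then have "card (unhit m h) \<noteq> k" using double(3) by linarith
  then show ?thesis using double by (simp add: variant_def)
qed (simp_all add: variant_def)

lemma terminates:
  "\<nexists>c. c 0 = init_config p n m r \<and> (\<forall>j::nat. alg_step p n m adv (c j) (c (Suc j)))"
proof
  assume "\<exists>c. c 0 = init_config p n m r \<and> (\<forall>j::nat. alg_step p n m adv (c j) (c (Suc j)))"
  then obtain c where c0: "c 0 = init_config p n m r"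
    and st: "\<And>j. alg_step p n m adv (c j) (c (Suc j))" by blast
  have I: "config_inv p (c j)" for j
    proof (induction j)
    case (Suc j) then show ?case using inv_step[OF st] p_ge_1 by simp
  qed (use c0 inv_init in simp)
  have "variant (c j) + j \<le> variant (c 0)" for j
  proof (induction j)
    case (Suc j) then show ?case using variant_step[OF st I, of j] by linarith
  qed simp
  from this[of "Suc (variant (c 0))"] show False by simp
qed

lemma max_load_exists: "\<exists>v<n. \<forall>w<n. load m h w \<le> load m h v"
proof -
  have "\<exists>v\<in>{..<n}. load m h v = Max (load m h ` {..<n})"
    using Max_in[of "load m h ` {..<n}"] n_pos by fastforce
  then show ?thesis by (metis Max_ge finite_imageI finite_lessThan imageI lessThan_iff)
qed

section \<open>Final configurations and their cost\<close>

lemma stuck_Finished: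
  assumes "\<nexists>c'. alg_step p n m adv c c'"
  obtains b h where "c = (Finished, b, h)"
proof -
  obtain ph b h where c: "c = (ph, b, h)" by (cases c)
  show ?thesis
  proof (cases ph)
    case (Growing A)
    have "\<forall>i\<in>A. min b n \<le> card (gball h i)"
      using assms c Growing alg_step.grow not_le by metis
    then show ?thesis using assms c Growing alg_step.enter_loop alg_step.exit_loop by metis
  next
    case (Selecting k)
    then show ?thesis
      using assms c max_load_exists[of h] alg_step.select alg_step.double not_le by metis
  next
    case Finished then show ?thesis using that c by simp
  qed
qed

lemma cost_bound:
  assumes "config_inv q (Finished, b, h)" "0 \<le> q"
  shows "(\<Sum>i<m. ball_cost q h i)
    \<le> 2 * (2 powr (p + 2) + 1) powr q * (m * (real n / r) powr q)"
proof -
  have "real b0 powr q \<le> ((2 powr (p + 2) + 1) * (real n / r)) powr q"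
    using b0_le assms(2) by (intro powr_mono2) auto
  also have "\<dots> = (2 powr (p + 2) + 1) powr q * (real n / r) powr q"
    using r_ge_1 by (intro powr_mult)
  finally have "2 * m * b0 powr q \<le> 2 * m * ((2 powr (p + 2) + 1) powr q * (real n / r) powr q)"
    by (intro mult_left_mono) auto
  then show ?thesis using assms(1) by (simp add: mult_ac)
qed

lemma stuck_correct:
  assumes "reach c" "\<nexists>c'. alg_step p n m adv c c'"
  shows "\<exists>b h. c = (Finished, b, h) \<and> centers h \<subseteq> {..<n} \<and> real (card (centers h)) \<le> r \<and>
    (\<forall>i<m. gball h i \<inter> centers h \<noteq> {}) \<and>
    total_cost p m h \<le> 2 * (2 powr (p + 2) + 1) powr p * (real m * cost_fun p (real n / r))"
proof -
  obtain b h where c: "c = (Finished, b, h)" using stuck_Finished[OF assms(2)] .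
  have I: "config_inv p (Finished, b, h)" using reach_inv[OF assms(1), of p] p_ge_1 c by simp
  then show ?thesis
    using c cost_bound[OF I] p_ge_1
    by (auto simp: wf_hist_def done_hist_def unhit_def total_cost_def cost_fun_def ball_cost_def)
qed

end

section \<open>Linked lists of nodes\<close>

text \<open>Node numbers start at 1; 0 is the null pointer.\<close>

fun chain :: "(nat \<Rightarrow> nat) \<Rightarrow> nat \<Rightarrow> nat list \<Rightarrow> bool" where
  "chain nxt x [] \<longleftrightarrow> x = 0"
| "chain nxt x (y # ys) \<longleftrightarrow> x = y \<and> y \<noteq> 0 \<and> chain nxt (nxt y) ys"

lemma chain_upd: "g \<notin> set ys \<Longrightarrow> chain (nxt(g := z)) x ys = chain nxt x ys"
  by (induction ys arbitrary: x) auto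

text \<open>New nodes have the largest number and are inserted at the front, so every linked list is
  the decreasing list of the nodes with a given key. The invariants can thus name its content
  without carrying lists along.\<close>

definition nodes :: "(nat \<Rightarrow> nat) \<Rightarrow> nat \<Rightarrow> nat \<Rightarrow> nat list" where
  "nodes key k G = rev (filter (\<lambda>g. key g = k) [1..<Suc G])"

lemma set_nodes: "set (nodes key k G) = {g \<in> {1..G}. key g = k}"
  by (auto simp: nodes_def)

lemma distinct_nodes: "distinct (nodes key k G)"
  by (simp add: nodes_def)

lemma nodes_0 [simp]: "nodes key k 0 = []"
  by (simp add: nodes_def)

lemma nodes_upd_Suc: "nodes (key(Suc G := j)) k (Suc G)
    = (if j = k then Suc G # nodes key k G else nodes key k G)"
proof -
  have "filter (\<lambda>g. (key(Suc G := j)) g = k) [1..<Suc G] = filter (\<lambda>g. key g = k) [1..<Suc G]"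
    by (rule filter_cong) auto
  then show ?thesis by (simp add: nodes_def)
qed

text \<open>Serves the lists of balls, of vertices and of buckets alike. The cell
  \<open>Suc G\<close> lies on no old list, so writing its successor disturbs none.\<close>

lemma chain_link:
  assumes "chain nxt (fst_node k) (nodes key k G)"
  shows "chain (nxt(Suc G := fst_node j)) ((fst_node(j := Suc G)) k) (nodes (key(Suc G := j)) k (Suc G))"
proof -
  have "Suc G \<notin> set (nodes key k G)" by (simp add: set_nodes)
  then show ?thesis using assms by (simp add: nodes_upd_Suc chain_upd)
qed

text \<open>A node leaves its bucket by receiving key 0, which stands for no bucket; therefore
  \<open>k' \<noteq> 0\<close>.\<close>

lemma nodes_pop:
  assumes "nodes key k G = g # ys" "k' \<noteq> 0"
  shows "nodes (key(g := 0)) k' G = (if k' = k then ys else nodes key k' G)"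
proof -
  have *: "nodes (key(g := 0)) k' G = filter (\<lambda>x. x \<noteq> g) (nodes key k' G)"
    using assms(2) by (auto simp: nodes_def rev_filter intro!: filter_cong)
  show ?thesis
  proof (cases "k' = k")
    case True
    have "distinct (g # ys)" using assms(1) distinct_nodes by metis
    then show ?thesis using * assms(1) True by (auto simp: filter_id_conv)
  next
    case False
    have "g \<in> set (nodes key k G)" using assms(1) by simp
    then have "g \<notin> set (nodes key k' G)" using False by (auto simp: set_nodes)
    then show ?thesis using * False by (auto simp: filter_id_conv)
  qed
qed

section \<open>Counting nodes with a given property\<close>

definition count_upto :: "(nat \<Rightarrow> bool) \<Rightarrow> nat \<Rightarrow> nat" where
  "count_upto P G = card {g \<in> {1..G}. P g}"

lemma count_upto_0 [simp]: "count_upto P 0 = 0"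
  by (simp add: count_upto_def)

lemma count_upto_Suc: "count_upto P (Suc G) = count_upto P G + (if P (Suc G) then 1 else 0)"
proof -
  have "{g \<in> {1..Suc G}. P g} = {g \<in> {1..G}. P g} \<union> (if P (Suc G) then {Suc G} else {})"
    by (auto simp: le_Suc_eq)
  then show ?thesis by (simp add: count_upto_def)
qed

lemma count_upto_cong: "(\<And>g. 1 \<le> g \<Longrightarrow> g \<le> G \<Longrightarrow> P g = P' g) \<Longrightarrow> count_upto P G = count_upto P' G"
  unfolding count_upto_def by (rule arg_cong[of _ _ card]) auto

lemma count_upto_split: "count_upto P G = count_upto (\<lambda>g. P g \<and> R g) G + count_upto (\<lambda>g. P g \<and> \<not> R g) G"
proof -
  have "{g \<in> {1..G}. P g} = {g \<in> {1..G}. P g \<and> R g} \<union> {g \<in> {1..G}. P g \<and> \<not> R g}" by auto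
  also have "card \<dots> = card {g \<in> {1..G}. P g \<and> R g} + card {g \<in> {1..G}. P g \<and> \<not> R g}"
    by (rule card_Un_disjoint) auto
  finally show ?thesis by (simp add: count_upto_def)
qed

lemma count_upto_remove:
  assumes "g \<in> {1..G}" "P g"
  shows "count_upto P G = Suc (count_upto (\<lambda>x. P x \<and> x \<noteq> g) G)"
proof -
  have "{x \<in> {1..G}. P x} = insert g {x \<in> {1..G}. P x \<and> x \<noteq> g}" using assms by auto
  then show ?thesis unfolding count_upto_def by simp
qed

lemma count_upto_pos: "0 < count_upto P G \<longleftrightarrow> (\<exists>g\<in>{1..G}. P g)"
  by (auto simp: count_upto_def card_gt_0_iff)

lemma length_nodes: "length (nodes key k G) = count_upto (\<lambda>g. key g = k) G"
  unfolding count_upto_def set_nodes[symmetric] by (simp add: distinct_card distinct_nodes)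

lemma length_filter_nodes:
  "length (filter P (nodes key k G)) = count_upto (\<lambda>g. key g = k \<and> P g) G"
proof -
  have "length (filter P (nodes key k G)) = card (set (filter P (nodes key k G)))"
    by (metis distinct_card distinct_filter distinct_nodes)
  also have "set (filter P (nodes key k G)) = {g \<in> {1..G}. key g = k \<and> P g}"
    by (auto simp: set_nodes)
  finally show ?thesis by (simp add: count_upto_def)
qed

section \<open>The program\<close>

text \<open>Scalars \<open>v\<dots>\<close> occupy cell 0 of their array; 0 and 1 are fixed by the input. \<open>vB\<close>, \<open>vU\<close>, \<open>vG\<close> hold \<open>b\<close>,
  the number of unhit balls and the number of requests, \<open>vD\<close> an upper bound of all loads, \<open>vQ\<close> the quota
  of the phase. The balls of the current phase are the segment from \<open>vLo\<close> to \<open>vHi\<close> of \<open>aQueue\<close>, which is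
  only ever appended to (at \<open>vEnd\<close>). \<open>aVert\<close>, \<open>aBall\<close>, \<open>aLevel\<close> and the \<open>Next\<close> arrays are indexed by
  nodes; \<open>aLevel\<close> is the bucket containing the node, or 0.\<close>

abbreviation (input) "vN \<equiv> 0 :: nat"
abbreviation (input) "vM \<equiv> 1 :: nat"
abbreviation (input) "vB \<equiv> 2 :: nat"
abbreviation (input) "vU \<equiv> 3 :: nat"
abbreviation (input) "vG \<equiv> 4 :: nat"
abbreviation (input) "vD \<equiv> 5 :: nat"
abbreviation (input) "vLo \<equiv> 6 :: nat"
abbreviation (input) "vHi \<equiv> 7 :: nat"
abbreviation (input) "vX \<equiv> 8 :: nat"
abbreviation (input) "vI \<equiv> 9 :: nat"
abbreviation (input) "vV \<equiv> 10 :: nat"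
abbreviation (input) "vY \<equiv> 11 :: nat"
abbreviation (input) "vZ \<equiv> 12 :: nat"
abbreviation (input) "vQ \<equiv> 13 :: nat"
abbreviation (input) "vEnd \<equiv> 14 :: nat"
abbreviation (input) "aQueue \<equiv> 20 :: nat"
abbreviation (input) "aVert \<equiv> 21 :: nat"
abbreviation (input) "aBall \<equiv> 22 :: nat"
abbreviation (input) "aBallNext \<equiv> 23 :: nat"
abbreviation (input) "aBallHead \<equiv> 24 :: nat"
abbreviation (input) "aVertNext \<equiv> 25 :: nat"
abbreviation (input) "aVertHead \<equiv> 26 :: nat"
abbreviation (input) "aLevNext \<equiv> 27 :: nat"
abbreviation (input) "aLevHead \<equiv> 28 :: nat"
abbreviation (input) "aLevel \<equiv> 29 :: nat"
abbreviation (input) "aLoad \<equiv> 30 :: nat"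
abbreviation (input) "aHit \<equiv> 31 :: nat"
abbreviation (input) "aCenter \<equiv> 32 :: nat"
abbreviation (input) "aSize \<equiv> 33 :: nat"

abbreviation Var :: "nat \<Rightarrow> expr" where "Var a \<equiv> Cell a (Num 0)"
abbreviation Set_var :: "nat \<Rightarrow> expr \<Rightarrow> com" where "Set_var a e \<equiv> Assign a (Num 0) e"

fun seq :: "com list \<Rightarrow> com" where
  "seq [] = Skip"
| "seq [c] = c"
| "seq (c # cs) = Seq c (seq cs)"

definition hit_ball :: com where
  "hit_ball = seq [
     Assign aHit (Var vI) (Num 1),
     Set_var vU (Sub (Var vU) (Num 1)),
     Set_var vY (Cell aBallHead (Var vI)),
     While (Neg (Equal (Var vY) (Num 0))) (seq [
       Assign aLoad (Cell aVert (Var vY)) (Sub (Cell aLoad (Cell aVert (Var vY))) (Num 1)),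
       Set_var vY (Cell aBallNext (Var vY))])]"

definition push_node :: com where
  "push_node = seq [
     Assign aLoad (Var vV) (Add (Cell aLoad (Var vV)) (Num 1)),
     Cond (Less (Var vD) (Cell aLoad (Var vV))) (Set_var vD (Cell aLoad (Var vV))) Skip,
     Assign aLevel (Var vG) (Cell aLoad (Var vV)),
     Assign aLevNext (Var vG) (Cell aLevHead (Cell aLoad (Var vV))),
     Assign aLevHead (Cell aLoad (Var vV)) (Var vG)]"

definition new_node :: com where
  "new_node = seq [
     Set_var vG (Add (Var vG) (Num 1)),
     Request aVert (Var vG) (Var vI),
     Set_var vV (Cell aVert (Var vG)),
     Assign aBall (Var vG) (Var vI),
     Assign aSize (Var vI) (Add (Cell aSize (Var vI)) (Num 1)),
     Assign aBallNext (Var vG) (Cell aBallHead (Var vI)),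
     Assign aBallHead (Var vI) (Var vG),
     Assign aVertNext (Var vG) (Cell aVertHead (Var vV)),
     Assign aVertHead (Var vV) (Var vG)]"

text \<open>Nodes of a ball already hit contribute to no load and enter no bucket. If the new vertex
  is a center, its node is pushed nevertheless before the ball is hit, so that
  \<open>hit_ball\<close> may decrement uniformly along the complete list.\<close>

definition grow_once :: com where
  "grow_once = seq [
     new_node,
     Cond (Equal (Cell aHit (Var vI)) (Num 0))
       (seq [push_node, Cond (Equal (Cell aCenter (Var vV)) (Num 0)) Skip hit_ball])
       (Assign aLevel (Var vG) (Num 0))]"

text \<open>The entry found stays in its bucket. Selecting its vertex brings the load to 0, so a
  later search meets it as outdated.\<close>

definition find_max :: com where
  "find_max =
     While (Neg (Conj (Neg (Equal (Cell aLevHead (Var vD)) (Num 0)))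
         (Equal (Cell aLoad (Cell aVert (Cell aLevHead (Var vD)))) (Var vD))))
       (Cond (Equal (Cell aLevHead (Var vD)) (Num 0))
         (Set_var vD (Sub (Var vD) (Num 1)))
         (seq [
           Assign aLevel (Cell aLevHead (Var vD)) (Num 0),
           Assign aLevHead (Var vD) (Cell aLevNext (Cell aLevHead (Var vD)))]))"

definition hit_vertex :: com where
  "hit_vertex = While (Neg (Equal (Var vZ) (Num 0))) (seq [
     Set_var vI (Cell aBall (Var vZ)),
     Cond (Equal (Cell aHit (Var vI)) (Num 0)) hit_ball Skip,
     Set_var vZ (Cell aVertNext (Var vZ))])"

definition select_center :: com where
  "select_center = seq [
     find_max,
     Set_var vV (Cell aVert (Cell aLevHead (Var vD))),
     Emit (Var vV),
     Assign aCenter (Var vV) (Num 1),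
     Set_var vZ (Cell aVertHead (Var vV)),
     hit_vertex]"

definition grow_ball :: com where
  "grow_ball = While (Conj (Less (Cell aSize (Var vI)) (Var vB)) (Less (Cell aSize (Var vI)) (Var vN)))
     grow_once"

text \<open>Reading \<open>aHit\<close> only when a ball is taken from the queue still yields the
  balls unhit at the start of the phase: growing one ball hits no other, and no center is selected
  meanwhile.\<close>

definition grow_phase :: com where
  "grow_phase = seq [
     Set_var vEnd (Var vHi),
     Set_var vX (Var vLo),
     While (Less (Var vX) (Var vHi)) (seq [
       Set_var vI (Cell aQueue (Var vX)),
       Cond (Equal (Cell aHit (Var vI)) (Num 0))
         (seq [
           Assign aQueue (Var vEnd) (Var vI),
           Set_var vEnd (Add (Var vEnd) (Num 1)),
           grow_ball])
         Skip,
       Set_var vX (Add (Var vX) (Num 1))]),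
     Set_var vLo (Var vHi),
     Set_var vHi (Var vEnd)]"

definition fill_queue :: com where
  "fill_queue = While (Less (Var vX) (Var vM)) (seq [
     Assign aQueue (Var vX) (Var vX),
     Set_var vX (Add (Var vX) (Num 1))])"

definition program :: com where
  "program = seq [
     Set_var vB StartSize,
     Set_var vU (Var vM),
     Set_var vHi (Var vM),
     fill_queue,
     grow_phase,
     While (Neg (Equal (Var vU) (Num 0))) (seq [
       Set_var vQ (Quota (Var vU)),
       While (Less (Var vQ) (Var vU)) select_center,
       Set_var vB (Add (Var vB) (Var vB)),
       grow_phase])]"

definition live :: "memory \<Rightarrow> nat" where
  "live s = count_upto (\<lambda>g. s aHit (s aBall g) = 0) (s vG 0)"

definition unselected :: "memory \<Rightarrow> nat" where
  "unselected s = count_upto (\<lambda>g. s aCenter (s aVert g) = 0) (s vG 0)"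

definition queued :: "memory \<Rightarrow> nat" where
  "queued s = count_upto (\<lambda>g. s aLevel g \<noteq> 0) (s vG 0)"

text \<open>A clock \<open>t\<close> is within budget if 200 units per request, together with \<open>w\<close> units granted separately,
  pay for the time spent so far and leave 40 units for each node that may still be
  traversed with its ball, traversed with its vertex, or discarded from its bucket, and for each decrement of \<open>vD\<close>.\<close>

definition budget :: "nat \<Rightarrow> memory \<Rightarrow> nat \<Rightarrow> bool" where
  "budget t s w \<longleftrightarrow> t + 40 * live s + 40 * unselected s + 40 * queued s + 40 * s vD 0 \<le> 200 * s vG 0 + w"

section \<open>Weakest preconditions with a clock\<close>

context hitting
begin

text \<open>Asserts a terminating run. The parameter \<open>t\<close> is the time at which
  \<open>c\<close> starts, so postconditions speak of absolute time and compose without adding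
  durations.\<close>

definition wp :: "com \<Rightarrow> (nat \<Rightarrow> memory \<Rightarrow> history \<Rightarrow> bool) \<Rightarrow> nat \<Rightarrow> memory \<Rightarrow> history \<Rightarrow> bool" where
  "wp c Q t s h \<longleftrightarrow> (\<exists>T s' h'. exec p n r adv c (s, h) T (s', h') \<and> Q (t + T) s' h')"

abbreviation val :: "memory \<Rightarrow> expr \<Rightarrow> nat" where "val \<equiv> eval p n r"

text \<open>Matches numerals with the nested \<open>Suc\<close> left by rules that each add one
  unit.\<close>

lemma clock:
  fixes t :: nat
  shows "t + 3 = Suc (Suc (Suc t))" "t + 4 = Suc (Suc (Suc (Suc t)))"
    "t + 5 = Suc (Suc (Suc (Suc (Suc t))))"
  by simp_all

lemma wp_Skip [simp]: "wp Skip Q t s h \<longleftrightarrow> Q (t + 1) s h"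
  unfolding wp_def by (subst exec.simps) auto

lemma wp_Assign [simp]:
  "wp (Assign a e e') Q t s h \<longleftrightarrow> Q (t + 1) (store s a (val s e) (val s e')) h"
  unfolding wp_def by (subst exec.simps) auto

lemma wp_Request [simp]:
  "wp (Request a e e') Q t s h \<longleftrightarrow>
     Q (t + 1) (store s a (val s e) (adv h (val s e'))) (h @ [Grow (val s e') (adv h (val s e'))])"
  unfolding wp_def by (subst exec.simps) auto

lemma wp_Emit [simp]: "wp (Emit e) Q t s h \<longleftrightarrow> Q (t + 1) s (h @ [Select (val s e)])"
  unfolding wp_def by (subst exec.simps) auto

lemma wp_Seq [simp]: "wp (Seq c c') Q t s h \<longleftrightarrow> wp c (wp c' Q) t s h"
proof
  assume "wp (Seq c c') Q t s h"
  then obtain T s' h' where e: "exec p n r adv (Seq c c') (s, h) T (s', h')" and Q: "Q (t + T) s' h'"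
    unfolding wp_def by blast
  from e obtain T1 T2 y where "T = T1 + T2" "exec p n r adv c (s, h) T1 y"
    "exec p n r adv c' y T2 (s', h')" by (cases rule: exec.cases) auto
  moreover obtain s1 h1 where "y = (s1, h1)" by (cases y)
  moreover have "Q (t + T1 + T2) s' h'" using Q \<open>T = T1 + T2\<close> by (simp add: add.assoc)
  ultimately show "wp c (wp c' Q) t s h"
    unfolding wp_def by blast
next
  assume "wp c (wp c' Q) t s h"
  then show "wp (Seq c c') Q t s h"
    unfolding wp_def using exec.Seq by (metis (no_types, opaque_lifting) add.assoc)
qed

lemma wp_Cond [simp]:
  "wp (Cond b c c') Q t s h \<longleftrightarrow> (if holds p n r s b then wp c Q (t + 1) s h else wp c' Q (t + 1) s h)"
  unfolding wp_def
  by (subst exec.simps) (auto, (metis Suc_eq_plus1 add_Suc_right add_Suc)+)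

lemma wp_While:
  "wp (While b c) Q t s h \<longleftrightarrow>
     (if holds p n r s b then wp c (wp (While b c) Q) (t + 1) s h else Q (t + 1) s h)"
proof (cases "holds p n r s b")
  case False
  then show ?thesis unfolding wp_def by (subst exec.simps) auto
next
  case True
  show ?thesis
  proof
    assume "wp (While b c) Q t s h"
    then obtain T s' h' where e: "exec p n r adv (While b c) (s, h) T (s', h')"
      and Q: "Q (t + T) s' h'" unfolding wp_def by blast
    from e True obtain T1 T2 y where "T = T1 + T2 + 1" "exec p n r adv c (s, h) T1 y"
      "exec p n r adv (While b c) y T2 (s', h')" by (cases rule: exec.cases) auto
    moreover obtain s1 h1 where "y = (s1, h1)" by (cases y)
    moreover have "Q (t + 1 + T1 + T2) s' h'" using Q \<open>T = T1 + T2 + 1\<close> by (simp add: add_ac)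
    ultimately have "wp c (wp (While b c) Q) (t + 1) s h"
      unfolding wp_def by blast
    then show "if holds p n r s b then wp c (wp (While b c) Q) (t + 1) s h else Q (t + 1) s h"
      using True by simp
  next
    assume "if holds p n r s b then wp c (wp (While b c) Q) (t + 1) s h else Q (t + 1) s h"
    then obtain T1 s1 h1 T2 s2 h2 where "exec p n r adv c (s, h) T1 (s1, h1)"
      "exec p n r adv (While b c) (s1, h1) T2 (s2, h2)" "Q (t + 1 + T1 + T2) s2 h2"
      using True unfolding wp_def by auto
    then show "wp (While b c) Q t s h"
      using exec.While_true[OF True] unfolding wp_def by (fastforce simp: add_ac)
  qed
qed

lemma wp_mono: "wp c Q t s h \<Longrightarrow> (\<And>t s h. Q t s h \<Longrightarrow> Q' t s h) \<Longrightarrow> wp c Q' t s h"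
  unfolding wp_def by blast

text \<open>The measure \<open>f\<close> serves termination only; bounds on time are put into
  \<open>I\<close>, which sees the clock.\<close>

lemma wp_While_rule:
  fixes f :: "memory \<Rightarrow> history \<Rightarrow> nat"
  assumes "I t s h"
    and "\<And>t s h. I t s h \<Longrightarrow> holds p n r s b \<Longrightarrow>
      wp c (\<lambda>t' s' h'. I t' s' h' \<and> f s' h' < f s h) (t + 1) s h"
    and "\<And>t s h. I t s h \<Longrightarrow> \<not> holds p n r s b \<Longrightarrow> Q (t + 1) s h"
  shows "wp (While b c) Q t s h"
  using assms(1)
proof (induction "f s h" arbitrary: t s h rule: less_induct)
  case less
  show ?case
  proof (cases "holds p n r s b")
    case True
    have "wp c (wp (While b c) Q) (t + 1) s h"
      using assms(2)[OF less.prems True] by (rule wp_mono) (use less.hyps in auto)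
    then show ?thesis using True by (subst wp_While) simp
  next
    case False
    then show ?thesis using assms(3)[OF less.prems] by (subst wp_While) simp
  qed
qed

section \<open>Correctness and running time\<close>

text \<open>A node is one answered request, and injectivity says that no vertex enters a ball twice.
  Marks, loads and buckets do not occur here, so updating them preserves \<open>rep\<close>.\<close>

definition rep :: "memory \<Rightarrow> history \<Rightarrow> bool" where
  "rep s h \<longleftrightarrow> s vN 0 = n \<and> s vM 0 = m \<and>
     (\<forall>i v. v \<in> gball h i \<longleftrightarrow> (\<exists>g\<in>{1..s vG 0}. s aBall g = i \<and> s aVert g = v)) \<and>
     inj_on (\<lambda>g. (s aBall g, s aVert g)) {1..s vG 0} \<and>
     (\<forall>v. v \<in> centers h \<longleftrightarrow> s aCenter v \<noteq> 0) \<and>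
     (\<forall>i. s aSize i = card (gball h i)) \<and>
     (\<forall>i. chain (s aBallNext) (s aBallHead i) (nodes (s aBall) i (s vG 0))) \<and>
     (\<forall>v. chain (s aVertNext) (s aVertHead v) (nodes (s aVert) v (s vG 0)))"

text \<open>The last clause says that a vertex of load \<open>d\<close> has an entry in each bucket
  from 1 to \<open>d\<close>. It survives every decrease of a load, and an entry may be dropped once
  the load of its vertex is below its bucket.\<close>

definition levels :: "memory \<Rightarrow> bool" where
  "levels s \<longleftrightarrow>
     (\<forall>k. k \<noteq> 0 \<longrightarrow> chain (s aLevNext) (s aLevHead k) (nodes (s aLevel) k (s vG 0))) \<and>
     (\<forall>v. s aLoad v \<le> s vD 0) \<and>
     (\<forall>v k. 1 \<le> k \<and> k \<le> s aLoad v \<longrightarrow> (\<exists>g\<in>{1..s vG 0}. s aVert g = v \<and> s aLevel g = k))"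

text \<open>Expressed through the marks \<open>aHit\<close> instead of \<open>unhit\<close>, hence
  true between the markings of two balls.\<close>

definition loads :: "memory \<Rightarrow> bool" where
  "loads s \<longleftrightarrow>
     (\<forall>v. s aLoad v = count_upto (\<lambda>g. s aVert g = v \<and> s aHit (s aBall g) = 0) (s vG 0)) \<and>
     s vU 0 = card {i. i < m \<and> s aHit i = 0}"

text \<open>Temporarily violated while the balls containing a new center are being marked.\<close>

definition synced :: "memory \<Rightarrow> history \<Rightarrow> bool" where
  "synced s h \<longleftrightarrow> (\<forall>i<m. s aHit i = 0 \<longleftrightarrow> i \<in> unhit m h)"

section \<open>Marking a ball as hit\<close>

lemma wp_decrement_loads:
  assumes "chain (s aBallNext) (s vY 0) ys"
    and "\<And>s'. (\<And>a. a \<noteq> vY \<Longrightarrow> a \<noteq> aLoad \<Longrightarrow> s' a = s a) \<Longrightarrow>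
       (\<And>v. s' aLoad v = s aLoad v - length (filter (\<lambda>g. s aVert g = v) ys)) \<Longrightarrow>
       Q (t + 3 * length ys + 1) s' h"
  shows "wp (While (Neg (Equal (Var vY) (Num 0))) (seq [
       Assign aLoad (Cell aVert (Var vY)) (Sub (Cell aLoad (Cell aVert (Var vY))) (Num 1)),
       Set_var vY (Cell aBallNext (Var vY))])) Q t s h"
  using assms
proof (induction ys arbitrary: s t)
  case Nil
  then show ?case by (subst wp_While) simp
next
  case (Cons y ys)
  let ?s = "store (store s aLoad (s aVert y) (s aLoad (s aVert y) - 1)) vY 0 (s aBallNext y)"
  have "wp (While (Neg (Equal (Var vY) (Num 0))) (seq [
       Assign aLoad (Cell aVert (Var vY)) (Sub (Cell aLoad (Cell aVert (Var vY))) (Num 1)),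
       Set_var vY (Cell aBallNext (Var vY))])) Q (t + 3) ?s h"
  proof (rule Cons.IH)
    show "chain (?s aBallNext) (?s vY 0) ys" using Cons.prems(1) by (simp add: store_def)
    fix s'
    assume 1: "\<And>a. a \<noteq> vY \<Longrightarrow> a \<noteq> aLoad \<Longrightarrow> s' a = ?s a"
      and 2: "\<And>v. s' aLoad v = ?s aLoad v - length (filter (\<lambda>g. ?s aVert g = v) ys)"
    have "Q (t + 3 * length (y # ys) + 1) s' h"
    proof (rule Cons.prems(2))
      show "s' a = s a" if "a \<noteq> vY" "a \<noteq> aLoad" for a using 1[OF that] that by (simp add: store_def)
      show "s' aLoad v = s aLoad v - length (filter (\<lambda>g. s aVert g = v) (y # ys))" for v
        using 2[of v] by (simp add: store_def)
    qed
    then show "Q (t + 3 + 3 * length ys + 1) s' h" by (simp add: add_ac)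
  qed
  moreover have "s vY 0 = y" "y \<noteq> 0" using Cons.prems(1) by auto
  ultimately show ?case
    by (subst wp_While) (simp add: store_def clock add_ac)
qed

text \<open>The time \<open>e\<close> is what the caller has already set aside for later. Each node
  of the ball releases 40 units and needs 3; the ball is nonempty, so the remaining constant
  overhead is covered as well and at least 20 units are handed back.\<close>

lemma wp_hit_ball:
  assumes rep: "rep s h" and lev: "levels s" and lo: "loads s"
    and i: "s vI 0 < m" "s aHit (s vI 0) = 0" "gball h (s vI 0) \<noteq> {}"
    and bud: "budget (t + e) s w"
    and post: "\<And>t' s'. rep s' h \<Longrightarrow> levels s' \<Longrightarrow> loads s' \<Longrightarrow> budget (t' + e + 20) s' w \<Longrightarrow>
      s' aHit = (s aHit)(s vI 0 := 1) \<Longrightarrow>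
      (\<And>a. a \<notin> {vU, vY, aLoad, aHit} \<Longrightarrow> s' a = s a) \<Longrightarrow> Q t' s' h"
  shows "wp hit_ball Q t s h"
proof -
  let ?i = "s vI 0"
  let ?G = "s vG 0"
  let ?L = "nodes (s aBall) ?i ?G"
  let ?s = "s(aHit := (s aHit)(?i := 1), vU := (s vU)(0 := s vU 0 - 1), vY := (s vY)(0 := s aBallHead ?i))"
  have ch: "chain (s aBallNext) (s aBallHead ?i) ?L" using rep by (simp add: rep_def)
  have "wp (While (Neg (Equal (Var vY) (Num 0))) (seq [
       Assign aLoad (Cell aVert (Var vY)) (Sub (Cell aLoad (Cell aVert (Var vY))) (Num 1)),
       Set_var vY (Cell aBallNext (Var vY))])) Q (t + 3) ?s h"
  proof (rule wp_decrement_loads)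
    show "chain (?s aBallNext) (?s vY 0) ?L" using ch by simp
    fix s'
    assume fr: "\<And>a. a \<noteq> vY \<Longrightarrow> a \<noteq> aLoad \<Longrightarrow> s' a = ?s a"
      and ld: "\<And>v. s' aLoad v = ?s aLoad v - length (filter (\<lambda>g. ?s aVert g = v) ?L)"
    have same: "s' a = s a" if "a \<notin> {vU, vY, aLoad, aHit}" for a using fr[of a] that by simp
    have hit: "s' aHit = (s aHit)(?i := 1)" using fr[of aHit] by simp
    have u: "s' vU 0 = s vU 0 - 1" using fr[of vU] by simp
    have load: "s' aLoad v = s aLoad v - count_upto (\<lambda>g. s aBall g = ?i \<and> s aVert g = v) ?G" for v
      using ld[of v] by (simp add: length_filter_nodes)
    have le: "s' aLoad v \<le> s aLoad v" for v using load by simp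
    have "rep s' h" using rep by (simp add: rep_def same)
    moreover have "levels s'"
      using lev le unfolding levels_def by (simp add: same) (meson le_trans)
    moreover have "loads s'"
    proof -
      \<comment> \<open>The nodes of \<open>?i\<close> at \<open>v\<close> are among those counted
        by the old load, so the truncated subtraction is exact.\<close>
      have "s' aLoad v = count_upto (\<lambda>g. s aVert g = v \<and> s' aHit (s aBall g) = 0) ?G" for v
      proof -
        have "s aLoad v = count_upto (\<lambda>g. s aVert g = v \<and> s aHit (s aBall g) = 0) ?G"
          using lo by (simp add: loads_def)
        also have "\<dots> = count_upto (\<lambda>g. (s aVert g = v \<and> s aHit (s aBall g) = 0) \<and> s aBall g = ?i) ?G
            + count_upto (\<lambda>g. (s aVert g = v \<and> s aHit (s aBall g) = 0) \<and> s aBall g \<noteq> ?i) ?G"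
          by (rule count_upto_split)
        also have "count_upto (\<lambda>g. (s aVert g = v \<and> s aHit (s aBall g) = 0) \<and> s aBall g = ?i) ?G
            = count_upto (\<lambda>g. s aBall g = ?i \<and> s aVert g = v) ?G"
          using i(2) by (intro count_upto_cong) auto
        also have "count_upto (\<lambda>g. (s aVert g = v \<and> s aHit (s aBall g) = 0) \<and> s aBall g \<noteq> ?i) ?G
            = count_upto (\<lambda>g. s aVert g = v \<and> s' aHit (s aBall g) = 0) ?G"
          by (intro count_upto_cong) (auto simp: hit)
        finally show ?thesis using load[of v] by simp
      qed
      moreover have "{i. i < m \<and> s' aHit i = 0} = {i. i < m \<and> s aHit i = 0} - {?i}"
        by (auto simp: hit)
      then have "s' vU 0 = card {i. i < m \<and> s' aHit i = 0}"
        using i lo u by (simp add: loads_def)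
      ultimately show ?thesis by (simp add: loads_def same)
    qed
    moreover have "budget (t + 3 + 3 * length ?L + 1 + e + 20) s' w"
    proof -
    have "live s = length ?L + live s'"
    proof -
      have "live s = count_upto (\<lambda>g. s aHit (s aBall g) = 0 \<and> s aBall g = ?i) ?G
          + count_upto (\<lambda>g. s aHit (s aBall g) = 0 \<and> s aBall g \<noteq> ?i) ?G"
        unfolding live_def by (rule count_upto_split)
      also have "count_upto (\<lambda>g. s aHit (s aBall g) = 0 \<and> s aBall g = ?i) ?G = length ?L"
        unfolding length_nodes using i(2) by (intro count_upto_cong) auto
      also have "count_upto (\<lambda>g. s aHit (s aBall g) = 0 \<and> s aBall g \<noteq> ?i) ?G = live s'"
        unfolding live_def same[of vG, simplified] same[of aBall, simplified]
        by (intro count_upto_cong) (auto simp: hit)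
      finally show ?thesis .
    qed
    moreover obtain v where "v \<in> gball h ?i" using i(3) by auto
    then have "0 < length ?L"
      using rep by (auto simp: rep_def length_nodes count_upto_pos)
    then have "1 \<le> length ?L" by linarith
    moreover have "unselected s' = unselected s" "queued s' = queued s" "s' vD 0 = s vD 0" "s' vG 0 = s vG 0"
      by (simp_all add: unselected_def queued_def same)
    ultimately show ?thesis
      using bud unfolding budget_def by linarith
    qed
    ultimately show "Q (t + 3 + 3 * length ?L + 1) s' h" using post hit same by blast
  qed
  then show ?thesis by (simp add: hit_ball_def store_def clock)
qed

section \<open>Meaning of nodes and loads in terms of the history\<close>

lemma rep_gball:
  "rep s h \<Longrightarrow> v \<in> gball h i \<longleftrightarrow> (\<exists>g\<in>{1..s vG 0}. s aBall g = i \<and> s aVert g = v)"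
  by (simp add: rep_def)

lemma node_gball:
  "rep s h \<Longrightarrow> g \<in> {1..s vG 0} \<Longrightarrow> s aVert g \<in> gball h (s aBall g)"
  by (auto simp: rep_def)

lemma node_bounds:
  assumes "rep s h" "wf_hist h" "g \<in> {1..s vG 0}"
  shows "s aBall g < m" "s aVert g < n"
  using node_gball[OF assms(1,3)] assms(2) by (fastforce simp: wf_hist_def not_le)+

text \<open>A node is determined by its ball and vertex, so the nodes of \<open>v\<close> in
  unmarked balls correspond bijectively to the unhit balls containing \<open>v\<close>.\<close>

lemma load_eq:
  assumes "rep s h" "loads s" "synced s h" "wf_hist h"
  shows "s aLoad v = load m h v"
proof -
  let ?N = "{g \<in> {1..s vG 0}. s aVert g = v \<and> s aHit (s aBall g) = 0}"
  have inj: "inj_on (\<lambda>g. (s aBall g, s aVert g)) {1..s vG 0}" using assms(1) by (simp add: rep_def)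
  have "inj_on (s aBall) ?N"
    by (rule inj_onI) (use inj in \<open>auto dest: inj_onD\<close>)
  then have "card (s aBall ` ?N) = card ?N" by (rule card_image)
  moreover have "s aBall ` ?N = {i \<in> unhit m h. v \<in> gball h i}"
  proof (intro equalityI subsetI)
    fix i assume "i \<in> s aBall ` ?N"
    then obtain g where g: "g \<in> {1..s vG 0}" "s aVert g = v" "s aHit i = 0" "i = s aBall g" by auto
    then show "i \<in> {i \<in> unhit m h. v \<in> gball h i}"
      using node_gball[OF assms(1) g(1)] node_bounds[OF assms(1,4) g(1)] assms(3)
      by (auto simp: synced_def)
  next
    fix i assume i: "i \<in> {i \<in> unhit m h. v \<in> gball h i}"
    then obtain g where "g \<in> {1..s vG 0}" "s aBall g = i" "s aVert g = v"
      using assms(1) by (auto simp: rep_def)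
    moreover have "s aHit i = 0" using i assms(3) by (auto simp: synced_def unhit_def)
    ultimately show "i \<in> s aBall ` ?N" by auto
  qed
  ultimately have "card ?N = load m h v" unfolding load_def by simp
  then show ?thesis using assms(2) by (simp add: loads_def count_upto_def)
qed

lemma unhit_count: "loads s \<Longrightarrow> synced s h \<Longrightarrow> s vU 0 = card (unhit m h)"
  unfolding loads_def synced_def
  by (elim conjE) (auto simp: unhit_def intro!: arg_cong[of _ _ card])

section \<open>Finding and selecting a vertex of maximal load\<close>

lemma wp_find_max:
  assumes rep: "rep s h" and lev: "levels s" and lo: "loads s"
    and ex: "0 < s aLoad v\<^sub>0" and bud: "budget t s w"
    and post: "\<And>t' s' g. rep s' h \<Longrightarrow> levels s' \<Longrightarrow> loads s' \<Longrightarrow> budget t' s' (w + 1) \<Longrightarrow>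
      g \<in> {1..s' vG 0} \<Longrightarrow> s' aLevHead (s' vD 0) = g \<Longrightarrow> s' aLoad (s' aVert g) = s' vD 0 \<Longrightarrow>
      (\<And>a. a \<notin> {vD, aLevel, aLevHead} \<Longrightarrow> s' a = s a) \<Longrightarrow> Q t' s' h"
  shows "wp find_max Q t s h"
  unfolding find_max_def
proof (rule wp_While_rule[where f = "\<lambda>s h. queued s + s vD 0" and
      I = "\<lambda>t' s' h'. h' = h \<and> levels s' \<and> budget t' s' w \<and>
             (\<forall>a. a \<notin> {vD, aLevel, aLevHead} \<longrightarrow> s' a = s a)"], goal_cases)
  case 1
  then show ?case using lev bud by simp
next
  case (2 t s' h')
  then have lev': "levels s'" and bud': "budget t s' w" and h': "h' = h"
    and same: "\<And>a. a \<notin> {vD, aLevel, aLevHead} \<Longrightarrow> s' a = s a" by auto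
  let ?d = "s' vD 0"
  let ?G = "s' vG 0"
  have le: "s' aLoad v \<le> ?d" for v using lev' by (simp add: levels_def)
  \<comment> \<open>Some load is positive, so the search never reaches bucket 0, whose list
    \<open>levels\<close> does not describe.\<close>
  have d: "0 < ?d" using ex le[of v\<^sub>0] same[of aLoad] by simp
  have ch: "chain (s' aLevNext) (s' aLevHead ?d) (nodes (s' aLevel) ?d ?G)"
    using lev' d by (simp add: levels_def)
  show ?case
  proof (cases "s' aLevHead ?d = 0")
    case True
    then have "nodes (s' aLevel) ?d ?G = []" using ch by (cases "nodes (s' aLevel) ?d ?G") auto
    then have none: "{g \<in> {1..?G}. s' aLevel g = ?d} = {}" using set_nodes by (metis set_empty)
    \<comment> \<open>A vertex of load \<open>?d\<close> would have an entry in this bucket; the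
      upper bound can be lowered.\<close>
    have "s' aLoad v \<noteq> ?d" for v
    proof
      assume "s' aLoad v = ?d"
      then have "\<exists>g\<in>{1..?G}. s' aVert g = v \<and> s' aLevel g = ?d"
        using lev' d unfolding levels_def by simp
      then show False using none by blast
    qed
    then have "s' aLoad v \<le> ?d - 1" for v using le[of v] by (metis Suc_pred' d le_neq_implies_less less_Suc_eq_le)
    then have "levels (store s' vD 0 (?d - 1))"
      using lev' by (simp add: levels_def store_def)
    moreover have "budget (t + 3) (store s' vD 0 (?d - 1)) w"
      using bud' d by (simp add: budget_def store_def live_def queued_def unselected_def)
    ultimately show ?thesis
      using True d h' same by (simp add: clock) (simp add: store_def queued_def)
  next
    case False
    then obtain g ys where ns: "nodes (s' aLevel) ?d ?G = g # ys" and g: "s' aLevHead ?d = g"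
      and ch': "chain (s' aLevNext) (s' aLevNext g) ys"
      using ch by (cases "nodes (s' aLevel) ?d ?G") auto
    have gG: "g \<in> {1..?G}" "s' aLevel g = ?d"
      using ns set_nodes[of "s' aLevel" ?d ?G] by auto
    have ne: "s' aLoad (s' aVert g) \<noteq> ?d" using 2(2) False g by simp
    let ?s = "store (store s' aLevel g 0) aLevHead ?d (s' aLevNext g)"
    have "levels ?s"
    proof -
      have "chain (s' aLevNext) (((s' aLevHead)(?d := s' aLevNext g)) k)
          (nodes ((s' aLevel)(g := 0)) k ?G)" if "k \<noteq> 0" for k
        using lev' ch' that by (simp add: nodes_pop[OF ns] levels_def)
      moreover have "\<exists>x\<in>{1..?G}. s' aVert x = v \<and> ((s' aLevel)(g := 0)) x = k"
        if k: "1 \<le> k" "k \<le> s' aLoad v" for v k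
      proof -
        obtain x where x: "x \<in> {1..?G}" "s' aVert x = v" "s' aLevel x = k"
          using lev' k unfolding levels_def by blast
        \<comment> \<open>The discarded entry could witness only a load of at least
          \<open>?d\<close>, but its vertex has load below \<open>?d\<close>.\<close>
        have "x \<noteq> g"
        proof
          assume "x = g"
          then have "?d \<le> s' aLoad (s' aVert g)" using x k gG by simp
          then show False using le[of "s' aVert g"] ne by simp
        qed
        then show ?thesis using x by auto
      qed
      ultimately show ?thesis using lev' by (simp add: levels_def store_def)
    qed
    moreover have q: "queued s' = Suc (queued ?s)"
    proof -
      have "count_upto (\<lambda>x. s' aLevel x \<noteq> 0 \<and> x \<noteq> g) ?G
          = count_upto (\<lambda>x. ((s' aLevel)(g := 0)) x \<noteq> 0) ?G"
        by (rule count_upto_cong) auto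
      then show ?thesis
        unfolding queued_def using count_upto_remove[OF gG(1), of "\<lambda>x. s' aLevel x \<noteq> 0"] gG d
        by (simp add: store_def)
    qed
    moreover have "budget (t + 4) ?s w"
    proof -
      have "live ?s = live s'" "unselected ?s = unselected s'" "?s vD 0 = s' vD 0" "?s vG 0 = s' vG 0"
        by (simp_all add: live_def unselected_def store_def)
      then show ?thesis using bud' q unfolding budget_def by linarith
    qed
    ultimately show ?thesis
      using False g h' same by (simp add: clock store_def)
  qed
next
  case (3 t s' h')
  then have lev': "levels s'" and bud': "budget t s' w" and h': "h' = h"
    and same: "\<And>a. a \<notin> {vD, aLevel, aLevHead} \<Longrightarrow> s' a = s a"
    and g: "s' aLevHead (s' vD 0) \<noteq> 0" "s' aLoad (s' aVert (s' aLevHead (s' vD 0))) = s' vD 0" by auto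
  let ?d = "s' vD 0"
  have "s' aLoad v\<^sub>0 \<le> ?d" using lev' by (simp add: levels_def)
  then have d: "?d \<noteq> 0" using ex same[of aLoad] by simp
  then have "chain (s' aLevNext) (s' aLevHead ?d) (nodes (s' aLevel) ?d (s' vG 0))"
    using lev' by (simp add: levels_def)
  then have "s' aLevHead ?d \<in> set (nodes (s' aLevel) ?d (s' vG 0))"
    using g(1) by (cases "nodes (s' aLevel) ?d (s' vG 0)") auto
  then have gG: "s' aLevHead ?d \<in> {1..s' vG 0}" by (simp add: set_nodes)
  have "Q (t + 1) s' h"
  proof (rule post[OF _ lev' _ _ gG refl g(2)])
    show "rep s' h" using rep by (simp add: rep_def same)
    show "loads s'" using lo by (simp add: loads_def same)
    show "budget (t + 1) s' (w + 1)" using bud' by (simp add: budget_def)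
  qed (use same in auto)
  then show ?case using h' by simp
qed

text \<open>Here \<open>ys\<close> is the part of the list still ahead. Five units per node pay for
  the traversal; the work of marking balls is paid by \<open>live\<close> inside
  \<open>hit_ball\<close>. Marks and history agree only after the whole list, so
  \<open>synced\<close> is replaced by an exact description of the marks.\<close>

lemma wp_hit_vertex:
  assumes "chain (s aVertNext) (s vZ 0) ys" "set ys \<subseteq> {1..s vG 0}"
    and "wf_hist h" "rep s h" "levels s" "loads s" "budget (t + 5 * length ys + 1 + e) s w"
    and "\<And>t' s'. rep s' h \<Longrightarrow> levels s' \<Longrightarrow> loads s' \<Longrightarrow> budget (t' + e) s' w \<Longrightarrow>
      (\<And>i. s' aHit i = 0 \<longleftrightarrow> s aHit i = 0 \<and> i \<notin> s aBall ` set ys) \<Longrightarrow>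
      (\<And>a. a \<notin> {vU, vI, vY, vZ, aLoad, aHit} \<Longrightarrow> s' a = s a) \<Longrightarrow> Q t' s' h"
  shows "wp hit_vertex Q t s h"
  using assms
proof (induction ys arbitrary: s t)
  case Nil
  then have "Q (t + 1) s h" by (intro Nil.prems(8)) auto
  then show ?case using Nil.prems(1) unfolding hit_vertex_def by (subst wp_While) simp
next
  case (Cons y ys)
  then have y: "s vZ 0 = y" "y \<noteq> 0" "y \<in> {1..s vG 0}" by auto
  let ?i = "s aBall y"
  let ?s = "store s vI 0 ?i"
  have inv: "rep ?s h" "levels ?s" "loads ?s"
    using Cons.prems(4-6) by (simp_all add: rep_def levels_def loads_def store_def)
  have bud: "budget (t + 5 * length (y # ys) + 1 + e) ?s w"
    using Cons.prems(7) by (simp add: budget_def live_def unselected_def queued_def store_def)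
  \<comment> \<open>Common continuation: the ball of \<open>y\<close> is marked now, whether by this
    iteration or earlier.\<close>
  have fin: "wp hit_vertex Q t' (store s' vZ 0 (s' aVertNext (s' vZ 0))) h"
    if s': "rep s' h" "levels s'" "loads s'" "budget (t' + 5 * length ys + 1 + e) s' w"
      "\<And>i. s' aHit i = 0 \<longleftrightarrow> s aHit i = 0 \<and> i \<noteq> ?i"
      "\<And>a. a \<notin> {vU, vI, vY, aLoad, aHit} \<Longrightarrow> s' a = s a" for t' s'
  proof (rule Cons.IH)
    let ?s2 = "store s' vZ 0 (s' aVertNext (s' vZ 0))"
    show "chain (?s2 aVertNext) (?s2 vZ 0) ys"
      using Cons.prems(1) s'(6) y by (simp add: store_def)
    show "set ys \<subseteq> {1..?s2 vG 0}" using Cons.prems(2) s'(6) by (simp add: store_def)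
    show "wf_hist h" by fact
    show "rep ?s2 h" "levels ?s2" "loads ?s2"
      using s'(1-3) by (simp_all add: rep_def levels_def loads_def store_def)
    show "budget (t' + 5 * length ys + 1 + e) ?s2 w"
      using s'(4) by (simp add: budget_def live_def unselected_def queued_def store_def)
    fix t2 s3
    assume a: "rep s3 h" "levels s3" "loads s3" "budget (t2 + e) s3 w"
      "\<And>i. s3 aHit i = 0 \<longleftrightarrow> ?s2 aHit i = 0 \<and> i \<notin> ?s2 aBall ` set ys"
      "\<And>a. a \<notin> {vU, vI, vY, vZ, aLoad, aHit} \<Longrightarrow> s3 a = ?s2 a"
    show "Q t2 s3 h"
    proof (rule Cons.prems(8))
      show "s3 aHit i = 0 \<longleftrightarrow> s aHit i = 0 \<and> i \<notin> s aBall ` set (y # ys)" for i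
        using a(5)[of i] s'(5)[of i] s'(6)[of aBall] by (auto simp: store_def)
      show "s3 a = s a" if "a \<notin> {vU, vI, vY, vZ, aLoad, aHit}" for a
        using a(6)[OF that] s'(6)[of a] that by (simp add: store_def)
    qed (use a in auto)
  qed
  have "wp (Cond (Equal (Cell aHit (Var vI)) (Num 0)) hit_ball Skip)
    (wp (Set_var vZ (Cell aVertNext (Var vZ))) (wp hit_vertex Q)) (t + 2) ?s h"
  proof (cases "s aHit ?i = 0")
    case True
    have "wp hit_ball (wp (Set_var vZ (Cell aVertNext (Var vZ))) (wp hit_vertex Q))
        (t + 3) ?s h"
    proof (rule wp_hit_ball[where w = w and e = "5 * length ys + e", OF inv])
      show "?s vI 0 < m" using node_bounds[OF Cons.prems(4,3) y(3)] by (simp add: store_def)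
      show "?s aHit (?s vI 0) = 0" using True by (simp add: store_def)
      show "gball h (?s vI 0) \<noteq> {}"
        using node_gball[OF Cons.prems(4) y(3)] by (auto simp: store_def)
      show "budget (t + 3 + (5 * length ys + e)) ?s w" using bud by (simp add: budget_def)
      fix t' s'
      assume a: "rep s' h" "levels s'" "loads s'" "budget (t' + (5 * length ys + e) + 20) s' w"
        "s' aHit = (?s aHit)(?s vI 0 := 1)"
        "\<And>a. a \<notin> {vU, vY, aLoad, aHit} \<Longrightarrow> s' a = ?s a"
      have "wp hit_vertex Q (t' + 1) (store s' vZ 0 (s' aVertNext (s' vZ 0))) h"
      proof (rule fin)
        show "budget (t' + 1 + 5 * length ys + 1 + e) s' w" using a(4) by (simp add: budget_def)
        show "s' aHit i = 0 \<longleftrightarrow> s aHit i = 0 \<and> i \<noteq> ?i" for i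
          using a(5) by (simp add: store_def)
        show "s' a = s a" if "a \<notin> {vU, vI, vY, aLoad, aHit}" for a
          using a(6)[of a] that by (simp add: store_def)
      qed (use a in auto)
      then show "wp (Set_var vZ (Cell aVertNext (Var vZ))) (wp hit_vertex Q) t' s' h" by simp
    qed
    then show ?thesis using True by (simp add: clock store_def)
  next
    case False
    have "wp hit_vertex Q (t + 5) (store ?s vZ 0 (?s aVertNext (?s vZ 0))) h"
    proof (rule fin[OF inv])
      show "budget (t + 5 + 5 * length ys + 1 + e) ?s w" using bud by (simp add: budget_def)
      show "?s aHit i = 0 \<longleftrightarrow> s aHit i = 0 \<and> i \<noteq> ?i" for i using False by (auto simp: store_def)
    qed (simp add: store_def)
    then show ?thesis using False by (simp add: clock store_def)
  qed
  then show ?case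
    using y unfolding hit_vertex_def by (subst wp_While) (simp add: clock)
qed

text \<open>The nodes of the selected vertex give up their \<open>unselected\<close> credit, which
  pays for the list traversal and for all constant costs, so nothing is charged per center. The unit
  in \<open>t' + 1\<close> pays for the test of the enclosing loop.\<close>

lemma wp_select_center:
  assumes reach: "reach (Selecting k, b, h)" and k: "real (card (unhit m h)) > real k / 2 powr (p + 1)"
    and rep: "rep s h" and lev: "levels s" and lo: "loads s" and syn: "synced s h"
    and bud: "budget t s w"
    and post: "\<And>t' s' h'. reach (Selecting k, b, h') \<Longrightarrow> rep s' h' \<Longrightarrow> levels s' \<Longrightarrow> loads s' \<Longrightarrow>
      synced s' h' \<Longrightarrow> budget (t' + 1) s' w \<Longrightarrow> unhit m h' \<subset> unhit m h \<Longrightarrow>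
      (\<And>a. a \<in> {vB, vLo, vHi, vQ, aQueue} \<Longrightarrow> s' a = s a) \<Longrightarrow> Q t' s' h'"
  shows "wp select_center Q t s h"
proof -
  have I: "config_inv 1 (Selecting k, b, h)" using reach_inv[OF reach, of 1] p_ge_1 by simp
  have wf: "wf_hist h" using I by simp
  have ne: "unhit m h \<noteq> {}" using k
    by (metis card.empty divide_nonneg_nonneg not_le of_nat_0 of_nat_0_le_iff powr_ge_zero)
  obtain v0 where v0: "\<forall>w<n. load m h w \<le> load m h v0" using max_load_exists by blast
  have "0 < s aLoad v0" using load_pos[OF I ne v0] load_eq[OF rep lo syn wf] by simp
  then have "wp find_max (wp (Seq (Set_var vV (Cell aVert (Cell aLevHead (Var vD)))) (Seq (Emit (Var vV))
     (Seq (Assign aCenter (Var vV) (Num 1)) (Seq (Set_var vZ (Cell aVertHead (Var vV))) hit_vertex)))) Q) t s h"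
  proof (rule wp_find_max[where w = w, OF rep lev lo])
    show "budget t s w" by fact
    fix t' s' g
    assume a: "rep s' h" "levels s'" "loads s'" "budget t' s' (w + 1)"
      "g \<in> {1..s' vG 0}" "s' aLevHead (s' vD 0) = g" "s' aLoad (s' aVert g) = s' vD 0"
      "\<And>a. a \<notin> {vD, aLevel, aLevHead} \<Longrightarrow> s' a = s a"
    define v where "v = s' aVert g"
    let ?h = "h @ [Select v]"
    let ?L = "nodes (s' aVert) v (s' vG 0)"
    have syn': "synced s' h" using syn a(8)[of aHit] by (simp add: synced_def)
    have ld: "load m h w = s' aLoad w" for w using load_eq[OF a(1,3) syn' wf] by simp
    have vn: "v < n" using node_bounds(2)[OF a(1) wf a(5)] by (simp add: v_def)
    have max: "\<forall>w<n. load m h w \<le> load m h v"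
      using a(2,7) by (simp add: ld levels_def v_def)
    have reach': "reach (Selecting k, b, ?h)"
      using alg_step.select[OF k vn max] reach by (meson rtranclp.rtrancl_into_rtrancl)
    have wf': "wf_hist ?h" using reach_inv[OF reach', of 1] p_ge_1 by simp
    \<comment> \<open>An unhit ball contains \<open>v\<close>, so \<open>v\<close> was no center
      before and all its nodes still hold their credit.\<close>
    have pos: "0 < load m h v" by (rule load_pos[OF I ne max])
    then have "{i \<in> unhit m h. v \<in> gball h i} \<noteq> {}" unfolding load_def by (metis card.empty less_irrefl)
    then obtain i where i: "i \<in> unhit m h" "v \<in> gball h i" by auto
    then have "v \<notin> centers h" by (auto simp: unhit_def)
    then have cen: "s' aCenter v = 0" using a(1) by (simp add: rep_def)
    define s2 where "s2 = s'(vV := (s' vV)(0 := v), aCenter := (s' aCenter)(v := 1),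
      vZ := (s' vZ)(0 := s' aVertHead v))"
    have s2: "s2 a = s' a" if "a \<notin> {vV, vZ, aCenter}" for a using that by (simp add: s2_def)
    have "unselected s' = length ?L + unselected s2"
    proof -
      have "unselected s' = count_upto (\<lambda>g. s' aCenter (s' aVert g) = 0 \<and> s' aVert g = v) (s' vG 0)
          + count_upto (\<lambda>g. s' aCenter (s' aVert g) = 0 \<and> s' aVert g \<noteq> v) (s' vG 0)"
        unfolding unselected_def by (rule count_upto_split)
      also have "count_upto (\<lambda>g. s' aCenter (s' aVert g) = 0 \<and> s' aVert g = v) (s' vG 0) = length ?L"
        unfolding length_nodes using cen by (intro count_upto_cong) auto
      also have "count_upto (\<lambda>g. s' aCenter (s' aVert g) = 0 \<and> s' aVert g \<noteq> v) (s' vG 0) = unselected s2"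
        unfolding unselected_def s2_def by (simp, intro count_upto_cong) auto
      finally show ?thesis .
    qed
    moreover have "1 \<le> length ?L"
      using a(5) count_upto_pos[of "\<lambda>g. s' aVert g = v" "s' vG 0"] unfolding length_nodes v_def by fastforce
    moreover have "live s2 = live s'" "queued s2 = queued s'" "s2 vD 0 = s' vD 0" "s2 vG 0 = s' vG 0"
      by (simp_all add: live_def queued_def s2)
    ultimately have bud2: "budget (t' + 4 + (5 * length ?L + 1 + 1)) s2 w"
      using a(4) unfolding budget_def by linarith
    have "wp hit_vertex Q (t' + 4) s2 ?h"
    proof (rule wp_hit_vertex[where ys = ?L and e = 1 and w = w])
      show "chain (s2 aVertNext) (s2 vZ 0) ?L"
        using a(1) by (simp add: s2_def rep_def)
      show "set ?L \<subseteq> {1..s2 vG 0}" by (auto simp: set_nodes s2)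
      show "wf_hist ?h" by fact
      show "rep s2 ?h" using a(1) unfolding rep_def s2_def by simp
      show "levels s2" "loads s2" using a(2,3) by (simp_all add: levels_def loads_def s2)
      show "budget (t' + 4 + 5 * length ?L + 1 + 1) s2 w" using bud2 by (simp add: add_ac)
      fix t3 s3
      assume c: "rep s3 ?h" "levels s3" "loads s3"
        "budget (t3 + 1) s3 w"
        "\<And>i. s3 aHit i = 0 \<longleftrightarrow> s2 aHit i = 0 \<and> i \<notin> s2 aBall ` set ?L"
        "\<And>a. a \<notin> {vU, vI, vY, vZ, aLoad, aHit} \<Longrightarrow> s3 a = s2 a"
      show "Q t3 s3 ?h"
      proof (rule post[OF reach' c(1-3)])
        show "synced s3 ?h"
        proof -
          have "i \<in> s' aBall ` set ?L \<longleftrightarrow> v \<in> gball h i" for i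
            by (auto simp: rep_gball[OF a(1)] set_nodes)
          then show ?thesis
            using syn' by (simp add: synced_def unhit_Select c(5) s2)
        qed
        show "budget (t3 + 1) s3 w" by fact
        show "unhit m ?h \<subset> unhit m h" using i by (auto simp: unhit_Select)
        show "s3 a = s a" if "a \<in> {vB, vLo, vHi, vQ, aQueue}" for a
          using that c(6)[of a] s2[of a] a(8)[of a] by (elim insertE) simp_all
      qed
    qed
    then show "wp (Seq (Set_var vV (Cell aVert (Cell aLevHead (Var vD)))) (Seq (Emit (Var vV))
     (Seq (Assign aCenter (Var vV) (Num 1)) (Seq (Set_var vZ (Cell aVertHead (Var vV))) hit_vertex)))) Q t' s' h"
      using a(6) by (simp add: store_def s2_def v_def clock)
  qed
  then show ?thesis by (simp add: select_center_def)
qed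

section \<open>Answering one grow request\<close>

lemma wp_new_node:
  fixes s h
  defines "i \<equiv> s vI 0"
  defines "v \<equiv> adv h i" and "G \<equiv> s vG 0"
  assumes post: "\<And>s'. s' vG 0 = Suc G \<Longrightarrow> s' vV 0 = v \<Longrightarrow>
      s' aVert = (s aVert)(Suc G := v) \<Longrightarrow> s' aBall = (s aBall)(Suc G := i) \<Longrightarrow>
      s' aSize = (s aSize)(i := s aSize i + 1) \<Longrightarrow>
      s' aBallNext = (s aBallNext)(Suc G := s aBallHead i) \<Longrightarrow>
      s' aBallHead = (s aBallHead)(i := Suc G) \<Longrightarrow>
      s' aVertNext = (s aVertNext)(Suc G := s aVertHead v) \<Longrightarrow>
      s' aVertHead = (s aVertHead)(v := Suc G) \<Longrightarrow>
      (\<And>a. a \<notin> {vG, vV, aVert, aBall, aSize, aBallNext, aBallHead, aVertNext, aVertHead} \<Longrightarrow> s' a = s a) \<Longrightarrow>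
      Q (t + 9) s' (h @ [Grow i v])"
  shows "wp new_node Q t s h"
proof -
  have nine: "Suc (Suc (Suc (Suc (Suc (Suc (Suc (Suc (Suc t)))))))) = t + 9" by simp
  show ?thesis
    unfolding new_node_def by (simp add: nine store_def) (rule post[unfolded v_def G_def i_def], simp_all)
qed

lemma wp_push_node:
  fixes s h
  defines "v \<equiv> s vV 0" and "G \<equiv> s vG 0"
  defines "k \<equiv> Suc (s aLoad v)"
  assumes post: "\<And>s'. s' aLoad = (s aLoad)(v := k) \<Longrightarrow> s' vD 0 = max (s vD 0) k \<Longrightarrow>
      s' aLevel = (s aLevel)(G := k) \<Longrightarrow>
      s' aLevNext = (s aLevNext)(G := s aLevHead k) \<Longrightarrow>
      s' aLevHead = (s aLevHead)(k := G) \<Longrightarrow>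
      (\<And>a. a \<notin> {aLoad, vD, aLevel, aLevNext, aLevHead} \<Longrightarrow> s' a = s a) \<Longrightarrow> Q (t + 6) s' h"
  shows "wp push_node Q t s h"
proof -
  have six: "Suc (Suc (Suc (Suc (Suc (Suc t))))) = t + 6" by simp
  show ?thesis
    unfolding push_node_def
    by (auto simp: six store_def; rule post[unfolded k_def v_def G_def]; simp)
qed

lemma rep_new_node:
  assumes rep: "rep s h" and new: "v \<notin> gball h i" and G: "G = s vG 0"
    and s': "s' vG 0 = Suc G" "s' vN 0 = s vN 0" "s' vM 0 = s vM 0"
      "s' aVert = (s aVert)(Suc G := v)" "s' aBall = (s aBall)(Suc G := i)"
      "s' aSize = (s aSize)(i := s aSize i + 1)" "s' aCenter = s aCenter"
      "s' aBallNext = (s aBallNext)(Suc G := s aBallHead i)"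
      "s' aBallHead = (s aBallHead)(i := Suc G)"
      "s' aVertNext = (s aVertNext)(Suc G := s aVertHead v)"
      "s' aVertHead = (s aVertHead)(v := Suc G)"
  shows "rep s' (h @ [Grow i v])"
proof -
  have "w \<in> gball (h @ [Grow i v]) j \<longleftrightarrow> (\<exists>g\<in>{1..Suc G}. s' aBall g = j \<and> s' aVert g = w)" for w j
  proof -
    have "(\<exists>g\<in>{1..Suc G}. s' aBall g = j \<and> s' aVert g = w) \<longleftrightarrow>
        (\<exists>g\<in>{1..G}. s aBall g = j \<and> s aVert g = w) \<or> (i = j \<and> v = w)"
      unfolding s' by (auto simp: atLeastAtMostSuc_conv)
    then show ?thesis by (auto simp: rep_gball[OF rep] G)
  qed
  moreover have "inj_on (\<lambda>g. (s' aBall g, s' aVert g)) {1..Suc G}"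
  proof -
    have "inj_on (\<lambda>g. (s aBall g, s aVert g)) {1..G}" using rep by (simp add: rep_def G)
    then have "inj_on (\<lambda>g. (s' aBall g, s' aVert g)) {1..G}"
      by (rule inj_on_cong[THEN iffD1, rotated]) (simp add: s')
    moreover have "(s' aBall (Suc G), s' aVert (Suc G)) \<notin> (\<lambda>g. (s' aBall g, s' aVert g)) ` {1..G}"
      using new by (auto simp: s' rep_gball[OF rep] G)
    ultimately show ?thesis by (simp add: atLeastAtMostSuc_conv)
  qed
  moreover have "chain (s' aBallNext) (s' aBallHead j) (nodes (s' aBall) j (Suc G))" for j
    unfolding s' using rep by (intro chain_link) (simp add: rep_def G)
  moreover have "chain (s' aVertNext) (s' aVertHead j) (nodes (s' aVert) j (Suc G))" for j
    unfolding s' using rep by (intro chain_link) (simp add: rep_def G)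
  moreover have "\<forall>j. s' aSize j = card (gball (h @ [Grow i v]) j)"
    using rep new by (simp add: s' rep_def)
  moreover have "s' vN 0 = n" "s' vM 0 = m" "\<forall>w. w \<in> centers (h @ [Grow i v]) \<longleftrightarrow> s' aCenter w \<noteq> 0"
    using rep s'(2,3,7) by (simp_all add: rep_def)
  ultimately show ?thesis unfolding rep_def s'(1) by simp
qed

text \<open>Only bucket \<open>k\<close> of \<open>v\<close> itself is a new obligation, and the new
  node fulfils it.\<close>

lemma levels_push:
  assumes lev: "levels s" and G: "G = s vG 0" and k: "k = Suc (s aLoad v)"
    and s': "s' vG 0 = Suc G" "s' aVert = (s aVert)(Suc G := v)"
      "s' aLoad = (s aLoad)(v := k)" "s' vD 0 = max (s vD 0) k"
      "s' aLevel = (s aLevel)(Suc G := k)"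
      "s' aLevNext = (s aLevNext)(Suc G := s aLevHead k)"
      "s' aLevHead = (s aLevHead)(k := Suc G)"
  shows "levels s'"
proof -
  have "chain (s' aLevNext) (s' aLevHead j) (nodes (s' aLevel) j (Suc G))" if "j \<noteq> 0" for j
    unfolding s' using lev that by (intro chain_link) (simp add: levels_def G)
  moreover have "s' aLoad w \<le> s' vD 0" for w
  proof -
    have "s aLoad w \<le> s vD 0" using lev by (simp add: levels_def)
    then show ?thesis by (auto simp: s')
  qed
  moreover have "\<exists>g\<in>{1..Suc G}. s' aVert g = w \<and> s' aLevel g = j" if j: "1 \<le> j" "j \<le> s' aLoad w" for w j
  proof (cases "w = v \<and> j = k")
    case True then show ?thesis by (auto simp: s')
  next
    case False
    then have "j \<le> s aLoad w" using j k by (auto simp: s' split: if_splits)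
    then obtain g where "g \<in> {1..G}" "s aVert g = w" "s aLevel g = j"
      using lev j unfolding levels_def G by blast
    then show ?thesis by (auto simp: s' intro!: bexI[of _ g])
  qed
  ultimately show ?thesis unfolding levels_def s'(1) by simp
qed

lemma levels_skip:
  assumes lev: "levels s" and G: "G = s vG 0"
    and s': "s' vG 0 = Suc G" "s' aVert = (s aVert)(Suc G := v)"
      "s' aLoad = s aLoad" "s' vD 0 = s vD 0" "s' aLevel = (s aLevel)(Suc G := 0)"
      "s' aLevNext = s aLevNext" "s' aLevHead = s aLevHead"
  shows "levels s'"
proof -
  have "chain (s' aLevNext) (s' aLevHead j) (nodes (s' aLevel) j (Suc G))" if "j \<noteq> 0" for j
    unfolding s' using lev that by (simp add: levels_def G nodes_upd_Suc)
  moreover have "\<exists>g\<in>{1..Suc G}. s' aVert g = w \<and> s' aLevel g = j" if j: "1 \<le> j" "j \<le> s' aLoad w" for w j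
  proof -
    obtain g where "g \<in> {1..G}" "s aVert g = w" "s aLevel g = j"
      using lev j unfolding levels_def G s' by blast
    then show ?thesis by (auto simp: s' intro!: bexI[of _ g])
  qed
  ultimately show ?thesis using lev unfolding levels_def s'(1) by (simp add: s')
qed

lemma loads_new_node:
  assumes lo: "loads s" and G: "G = s vG 0"
    and s': "s' vG 0 = Suc G" "s' vU 0 = s vU 0" "s' aHit = s aHit"
      "s' aVert = (s aVert)(Suc G := v)" "s' aBall = (s aBall)(Suc G := i)"
      "s' aLoad = (if s aHit i = 0 then (s aLoad)(v := Suc (s aLoad v)) else s aLoad)"
  shows "loads s'"
proof -
  have "count_upto (\<lambda>g. s' aVert g = w \<and> s' aHit (s' aBall g) = 0) (Suc G)
      = s aLoad w + (if v = w \<and> s aHit i = 0 then 1 else 0)" for w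
  proof -
    have "count_upto (\<lambda>g. s' aVert g = w \<and> s' aHit (s' aBall g) = 0) G
        = count_upto (\<lambda>g. s aVert g = w \<and> s aHit (s aBall g) = 0) G"
      by (rule count_upto_cong) (simp add: s')
    then show ?thesis using lo by (simp add: count_upto_Suc loads_def G s')
  qed
  then show ?thesis using lo by (simp add: loads_def s')
qed

lemma potential_new_node:
  assumes G: "G = s vG 0"
    and s': "s' vG 0 = Suc G" "s' aHit = s aHit" "s' aCenter = s aCenter"
      "s' aVert = (s aVert)(Suc G := v)" "s' aBall = (s aBall)(Suc G := i)"
      "s' aLevel = (s aLevel)(Suc G := k)"
  shows "live s' \<le> live s + 1" "unselected s' \<le> unselected s + 1" "queued s' \<le> queued s + 1"
proof -
  have "count_upto (\<lambda>g. s' aHit (s' aBall g) = 0) G = live s"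
    unfolding live_def G[symmetric] by (rule count_upto_cong) (simp add: s')
  then show "live s' \<le> live s + 1" unfolding live_def s'(1) count_upto_Suc by simp
  have "count_upto (\<lambda>g. s' aCenter (s' aVert g) = 0) G = unselected s"
    unfolding unselected_def G[symmetric] by (rule count_upto_cong) (simp add: s')
  then show "unselected s' \<le> unselected s + 1" unfolding unselected_def s'(1) count_upto_Suc by simp
  have "count_upto (\<lambda>g. s' aLevel g \<noteq> 0) G = queued s"
    unfolding queued_def G[symmetric] by (rule count_upto_cong) (simp add: s')
  then show "queued s' \<le> queued s + 1" unfolding queued_def s'(1) count_upto_Suc by simp
qed

lemma wp_grow_once:
  assumes reach: "reach (Growing A, b, h)" and i: "s vI 0 \<in> A" "card (gball h (s vI 0)) < min b n"
    and rep: "rep s h" and lev: "levels s" and lo: "loads s" and syn: "synced s h"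
    and bud: "budget t s w"
    and post: "\<And>t' s' v. reach (Growing A, b, h @ [Grow (s vI 0) v]) \<Longrightarrow> v \<notin> gball h (s vI 0) \<Longrightarrow>
      rep s' (h @ [Grow (s vI 0) v]) \<Longrightarrow> levels s' \<Longrightarrow> loads s' \<Longrightarrow>
      synced s' (h @ [Grow (s vI 0) v]) \<Longrightarrow> budget (t' + 1) s' w \<Longrightarrow>
      (\<And>a. a \<in> {vB, vLo, vHi, vX, vI, vEnd, aQueue} \<Longrightarrow> s' a = s a) \<Longrightarrow>
      Q t' s' (h @ [Grow (s vI 0) v])"
  shows "wp grow_once Q t s h"
proof -
  let ?i = "s vI 0"
  define v where "v = adv h ?i"
  define G where "G = s vG 0"
  let ?h = "h @ [Grow ?i v]"
  have wf: "wf_hist h" and im: "?i < m" using reach_inv[OF reach, of 1] p_ge_1 i by auto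
  have new: "v \<notin> gball h ?i" using adv_new(2)[OF im] wf i by (simp add: wf_hist_def v_def)
  have reach': "reach (Growing A, b, ?h)"
    using alg_step.grow[OF i] reach unfolding v_def by (meson rtranclp.rtrancl_into_rtrancl)
  \<comment> \<open>A request changes the set of unhit balls only if the adversary returns a
    center.\<close>
  have unhit': "j \<in> unhit m ?h \<longleftrightarrow> j \<in> unhit m h \<and> \<not> (j = ?i \<and> v \<in> centers h)" for j
    by (auto simp: unhit_def)
  have cen: "v \<in> centers h \<longleftrightarrow> s aCenter v \<noteq> 0" using rep by (simp add: rep_def)
  have hit: "s aHit ?i = 0 \<longleftrightarrow> ?i \<in> unhit m h" using syn im by (simp add: synced_def)
  have "wp new_node (wp (Cond (Equal (Cell aHit (Var vI)) (Num 0))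
       (seq [push_node, Cond (Equal (Cell aCenter (Var vV)) (Num 0)) Skip hit_ball])
       (Assign aLevel (Var vG) (Num 0))) Q) t s h"
  proof (rule wp_new_node, fold v_def G_def)
    fix s1
    assume s1: "s1 vG 0 = Suc G" "s1 vV 0 = v"
      "s1 aVert = (s aVert)(Suc G := v)" "s1 aBall = (s aBall)(Suc G := ?i)"
      "s1 aSize = (s aSize)(?i := s aSize ?i + 1)"
      "s1 aBallNext = (s aBallNext)(Suc G := s aBallHead ?i)"
      "s1 aBallHead = (s aBallHead)(?i := Suc G)"
      "s1 aVertNext = (s aVertNext)(Suc G := s aVertHead v)"
      "s1 aVertHead = (s aVertHead)(v := Suc G)"
      "\<And>a. a \<notin> {vG, vV, aVert, aBall, aSize, aBallNext, aBallHead, aVertNext, aVertHead} \<Longrightarrow> s1 a = s a"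
    show "wp (Cond (Equal (Cell aHit (Var vI)) (Num 0))
       (seq [push_node, Cond (Equal (Cell aCenter (Var vV)) (Num 0)) Skip hit_ball])
       (Assign aLevel (Var vG) (Num 0))) Q (t + 9) s1 ?h"
    proof (cases "s aHit ?i = 0")
      case False
      let ?s = "store s1 aLevel (Suc G) 0"
      have s2: "?s a = s1 a" if "a \<noteq> aLevel" for a using that by (simp add: store_def)
      have lv2: "?s aLevel = (s aLevel)(Suc G := 0)" using s1(10)[of aLevel] by (simp add: store_def)
      have "Q (t + 11) ?s ?h"
      proof (rule post[OF reach' new])
        show "rep ?s ?h" by (rule rep_new_node[OF rep new G_def]) (simp_all add: s2 s1)
        show "levels ?s" by (rule levels_skip[OF lev G_def]) (simp_all add: s2 s1 lv2)
        show "loads ?s" by (rule loads_new_node[OF lo G_def]) (use False in \<open>auto simp: s2 s1\<close>)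
        show "synced ?s ?h" using syn False hit by (auto simp: synced_def s2 s1 unhit')
        show "budget (t + 11 + 1) ?s w"
        proof -
          have "live ?s \<le> live s + 1" "unselected ?s \<le> unselected s + 1" "queued ?s \<le> queued s + 1"
            by (rule potential_new_node[where s = s, OF G_def]; simp add: s2 s1 lv2)+
          moreover have "?s vD 0 = s vD 0" "?s vG 0 = s vG 0 + 1"
            using s1(1) G_def by (simp_all add: store_def s1(10))
          ultimately show ?thesis using bud unfolding budget_def by linarith
        qed
        show "?s a = s a" if "a \<in> {vB, vLo, vHi, vX, vI, vEnd, aQueue}" for a
          using that by (elim insertE) (simp_all add: s2 s1)
      qed
      then show ?thesis using False by (simp add: s1 add.commute)
    next
      case True
      have "wp push_node (wp (Cond (Equal (Cell aCenter (Var vV)) (Num 0)) Skip hit_ball) Q) (t + 10) s1 ?h"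
      proof (rule wp_push_node, unfold s1(1,2))
        fix s2
        define k where "k = Suc (s aLoad v)"
        assume "s2 aLoad = (s1 aLoad)(v := Suc (s1 aLoad v))" "s2 vD 0 = max (s1 vD 0) (Suc (s1 aLoad v))"
          "s2 aLevel = (s1 aLevel)(Suc G := Suc (s1 aLoad v))"
          "s2 aLevNext = (s1 aLevNext)(Suc G := s1 aLevHead (Suc (s1 aLoad v)))"
          "s2 aLevHead = (s1 aLevHead)(Suc (s1 aLoad v) := Suc G)"
          and fr: "\<And>a. a \<notin> {aLoad, vD, aLevel, aLevNext, aLevHead} \<Longrightarrow> s2 a = s1 a"
        then have s2: "s2 aLoad = (s aLoad)(v := k)" "s2 vD 0 = max (s vD 0) k"
          "s2 aLevel = (s aLevel)(Suc G := k)" "s2 aLevNext = (s aLevNext)(Suc G := s aLevHead k)"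
          "s2 aLevHead = (s aLevHead)(k := Suc G)"
          by (simp_all add: s1(10) k_def)
        have rep2: "rep s2 ?h" by (rule rep_new_node[OF rep new G_def]) (simp_all add: fr s1)
        have lev2: "levels s2" by (rule levels_push[OF lev G_def k_def]) (simp_all add: s2 fr s1)
        have lo2: "loads s2" by (rule loads_new_node[OF lo G_def]) (use True in \<open>auto simp: s2 fr s1 k_def\<close>)
        \<comment> \<open>The request brings 200 units. Three new credits and a possible rise of
          \<open>vD\<close> take 40 each; of the remaining 40, 30 are put on the clock for the
          commands of this request.\<close>
        have bud2: "budget (t + 30) s2 w"
        proof -
          have "live s2 \<le> live s + 1" "unselected s2 \<le> unselected s + 1" "queued s2 \<le> queued s + 1"
            by (rule potential_new_node[where s = s, OF G_def]; simp add: s2 fr s1)+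
          moreover have "s aLoad v \<le> s vD 0" using lev by (simp add: levels_def)
          then have "s2 vD 0 \<le> s vD 0 + 1" by (simp add: s2 k_def)
          moreover have "s2 vG 0 = s vG 0 + 1" by (simp add: fr s1 G_def)
          ultimately show ?thesis using bud unfolding budget_def by linarith
        qed
        have same: "s2 a = s a" if "a \<in> {vB, vLo, vHi, vX, vI, vEnd, aQueue, aHit, aCenter}" for a
          using that by (elim insertE) (simp_all add: fr s1)
        show "wp (Cond (Equal (Cell aCenter (Var vV)) (Num 0)) Skip hit_ball) Q (t + 10 + 6) s2 ?h"
        proof (cases "s aCenter v = 0")
          case True
          have "Q (t + 18) s2 ?h"
          proof (rule post[OF reach' new rep2 lev2 lo2])
            show "synced s2 ?h" using syn True cen by (auto simp: synced_def same unhit')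
            show "budget (t + 18 + 1) s2 w" using bud2 by (simp add: budget_def)
          qed (use same in auto)
          then show ?thesis using True by (simp add: fr s1 add.commute)
        next
          case False
          have "wp hit_ball Q (t + 17) s2 ?h"
          proof (rule wp_hit_ball[where e = 0 and w = w, OF rep2 lev2 lo2])
            show "s2 vI 0 < m" "s2 aHit (s2 vI 0) = 0" "gball ?h (s2 vI 0) \<noteq> {}"
              using im True by (simp_all add: same)
            show "budget (t + 17 + 0) s2 w" using bud2 by (simp add: budget_def)
            fix t' s'
            assume a: "rep s' ?h" "levels s'" "loads s'" "budget (t' + 0 + 20) s' w"
              "s' aHit = (s2 aHit)(s2 vI 0 := 1)"
              "\<And>a. a \<notin> {vU, vY, aLoad, aHit} \<Longrightarrow> s' a = s2 a"
            show "Q t' s' ?h"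
            proof (rule post[OF reach' new a(1-3)])
              show "synced s' ?h" using syn False cen by (auto simp: synced_def same a(5) unhit')
              show "budget (t' + 1) s' w" using a(4) by (simp add: budget_def)
              show "s' a = s a" if "a \<in> {vB, vLo, vHi, vX, vI, vEnd, aQueue}" for a
                using that by (elim insertE) (simp_all add: a(6) same)
            qed
          qed
          then show ?thesis using False by (simp add: fr s1 add.commute)
        qed
      qed
      then show ?thesis using True by (simp add: s1 add.commute)
    qed
  qed
  then show ?thesis unfolding grow_once_def by simp
qed

section \<open>Growing balls, and phases over the queue\<close>

lemma wp_grow_ball:
  assumes reach: "reach (Growing A, b, h)" and i: "s vI 0 \<in> A" and b: "s vB 0 = b"
    and rep: "rep s h" and lev: "levels s" and lo: "loads s" and syn: "synced s h"
    and bud: "budget t s w"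
    and post: "\<And>t' s' h'. reach (Growing A, b, h') \<Longrightarrow>
      rep s' h' \<Longrightarrow> levels s' \<Longrightarrow> loads s' \<Longrightarrow> synced s' h' \<Longrightarrow> budget t' s' (w + 1) \<Longrightarrow>
      min b n \<le> card (gball h' (s vI 0)) \<Longrightarrow>
      centers h' = centers h \<Longrightarrow> (\<And>j. j \<noteq> s vI 0 \<Longrightarrow> gball h' j = gball h j) \<Longrightarrow>
      (\<And>a. a \<in> {vB, vLo, vHi, vX, vI, vEnd, aQueue} \<Longrightarrow> s' a = s a) \<Longrightarrow> Q t' s' h'"
  shows "wp grow_ball Q t s h"
  unfolding grow_ball_def
proof (rule wp_While_rule[where f = "\<lambda>s h. n - card (gball h (s vI 0))" and
      I = "\<lambda>t s' h'. reach (Growing A, b, h') \<and> rep s' h' \<and> levels s' \<and> loads s' \<and> synced s' h' \<and>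
        budget t s' w \<and> centers h' = centers h \<and> (\<forall>j. j \<noteq> s vI 0 \<longrightarrow> gball h' j = gball h j) \<and>
        (\<forall>a\<in>{vB, vLo, vHi, vX, vI, vEnd, aQueue}. s' a = s a)"], goal_cases)
  case 1
  then show ?case using assms by simp
next
  case (2 t s' h')
  then have I: "reach (Growing A, b, h')" "rep s' h'" "levels s'" "loads s'" "synced s' h'"
    "budget t s' w" "centers h' = centers h" "\<And>j. j \<noteq> s vI 0 \<Longrightarrow> gball h' j = gball h j"
    and same: "\<And>a. a \<in> {vB, vLo, vHi, vX, vI, vEnd, aQueue} \<Longrightarrow> s' a = s a" by auto
  have sz: "s' aSize j = card (gball h' j)" "s' vN 0 = n" for j using I(2) by (simp_all add: rep_def)
  have lt: "card (gball h' (s' vI 0)) < min b n" using 2(2) sz same b by simp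
  have i': "s' vI 0 \<in> A" using i same by simp
  show ?case
  proof (rule wp_grow_once[where w = "w + 1", OF I(1) i' lt I(2-5)], goal_cases)
    case 1
    then show ?case using I(6) by (simp add: budget_def)
  next
    case (2 t' s2 v)
    have "n - card (gball (h' @ [Grow (s' vI 0) v]) (s2 vI 0)) < n - card (gball h' (s' vI 0))"
      using 2(2) 2(8)[of vI] lt by (simp add: diff_less_mono2)
    moreover have "budget t' s2 w" using 2(7) by (simp add: budget_def)
    moreover have "\<forall>a\<in>{vB, vLo, vHi, vX, vI, vEnd, aQueue}. s2 a = s a"
      using 2(8) same by simp
    ultimately show ?case using 2(1-6) I(7,8) same by simp
  qed
next
  case (3 t s' h')
  then have I: "reach (Growing A, b, h')" "rep s' h'" "levels s'" "loads s'" "synced s' h'"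
    "budget t s' w" "centers h' = centers h" "\<And>j. j \<noteq> s vI 0 \<Longrightarrow> gball h' j = gball h j"
    and same: "\<And>a. a \<in> {vB, vLo, vHi, vX, vI, vEnd, aQueue} \<Longrightarrow> s' a = s a" by auto
  have sz: "s' aSize j = card (gball h' j)" "s' vN 0 = n" for j using I(2) by (simp_all add: rep_def)
  show ?case
  proof (rule post[OF I(1-5)])
    show "budget (t + 1) s' (w + 1)" using I(6) by (simp add: budget_def)
    show "min b n \<le> card (gball h' (s vI 0))" using 3(2) sz same b by auto
  qed (use I same in auto)
qed

text \<open>Seven units per queue entry: loop test, fetching the ball, mark test, two assignments to
  append it, the final test of \<open>grow_ball\<close>, and the increment. Five more are the four
  assignments around the loop and its last test.\<close>

lemma wp_grow_phase:
  fixes s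
  defines "lo \<equiv> s vLo 0" and "hi \<equiv> s vHi 0"
  assumes reach: "reach (Growing A, b, h)" and b: "s vB 0 = b" and A: "A = unhit m h"
    and rep: "rep s h" and lev: "levels s" and ld: "loads s" and syn: "synced s h"
    and le: "lo \<le> hi" and inj: "inj_on (s aQueue) {lo..<hi}"
    and sub: "A \<subseteq> s aQueue ` {lo..<hi}" "s aQueue ` {lo..<hi} \<subseteq> {..<m}"
    and bud: "budget t s w"
    and post: "\<And>t' s' h'. reach (Growing A, b, h') \<Longrightarrow>
      rep s' h' \<Longrightarrow> levels s' \<Longrightarrow> loads s' \<Longrightarrow> synced s' h' \<Longrightarrow> s' vB 0 = b \<Longrightarrow>
      \<forall>i\<in>A. min b n \<le> card (gball h' i) \<Longrightarrow> s' vLo 0 = hi \<Longrightarrow> s' vHi 0 = hi + card A \<Longrightarrow>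
      bij_betw (s' aQueue) {s' vLo 0..<s' vHi 0} A \<Longrightarrow>
      budget t' s' (w + 5 + 7 * (hi - lo)) \<Longrightarrow> Q t' s' h'"
  shows "wp grow_phase Q t s h"
proof -
  \<comment> \<open>The balls in \<open>s aQueue\<close> applied to positions from
    \<open>s' vX 0\<close> on are untreated and unchanged since \<open>h\<close>, so their marks
    still decide membership in \<open>A\<close>. Copies are written from \<open>hi\<close> on and
    leave the segment being read intact.\<close>
  define J where "J = (\<lambda>t' s' h'. lo \<le> s' vX 0 \<and> s' vX 0 \<le> hi \<and> hi \<le> s' vEnd 0 \<and> s' vHi 0 = hi \<and> s' vB 0 = b \<and>
      reach (Growing A, b, h') \<and> rep s' h' \<and> levels s' \<and> loads s' \<and> synced s' h' \<and>
      budget t' s' (w + 2 + 7 * (s' vX 0 - lo)) \<and>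
      (\<forall>x\<in>{lo..<hi}. s' aQueue x = s aQueue x) \<and>
      bij_betw (s' aQueue) {hi..<s' vEnd 0} (A - s aQueue ` {s' vX 0..<hi}) \<and>
      centers h' = centers h \<and> (\<forall>j\<in>s aQueue ` {s' vX 0..<hi}. gball h' j = gball h j) \<and>
      (\<forall>j\<in>A - s aQueue ` {s' vX 0..<hi}. min b n \<le> card (gball h' j)))"
  let ?body = "Seq (Set_var vI (Cell aQueue (Var vX)))
       (Seq (Cond (Equal (Cell aHit (Var vI)) (Num 0))
         (seq [
           Assign aQueue (Var vEnd) (Var vI),
           Set_var vEnd (Add (Var vEnd) (Num 1)),
           grow_ball])
         Skip)
       (Set_var vX (Add (Var vX) (Num 1))))"
  let ?loop = "While (Less (Var vX) (Var vHi)) ?body"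
  let ?fin = "Seq (Set_var vLo (Var vHi)) (Set_var vHi (Var vEnd))"
  have "wp ?loop (wp ?fin Q) (t + 2) (store (store s vEnd 0 hi) vX 0 lo) h"
  proof (rule wp_While_rule[where f = "\<lambda>s h. hi - s vX 0" and I = J], goal_cases)
    case 1
    have "A - s aQueue ` {lo..<hi} = {}" using sub by auto
    moreover let ?s = "store (store s vEnd 0 hi) vX 0 lo"
    have "rep ?s h" "levels ?s" "loads ?s" "synced ?s h"
      using rep lev ld syn by (simp_all add: rep_def levels_def loads_def synced_def store_def)
    moreover have "budget (t + 2) ?s (w + 2)"
      using bud by (simp add: budget_def live_def unselected_def queued_def store_def)
    moreover have "?s vX 0 = lo" "?s vEnd 0 = hi" "?s vHi 0 = hi" "?s vB 0 = b" "?s aQueue = s aQueue"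
      using b by (simp_all add: store_def hi_def)
    ultimately show ?case using reach le unfolding J_def by (simp add: bij_betw_def) blast
  next
    case (2 t s' h')
    define X where "X = s' vX 0"
    define E where "E = s' vEnd 0"
    define i where "i = s aQueue X"
    have J: "lo \<le> X" "hi \<le> E" "s' vHi 0 = hi" "s' vB 0 = b"
      "reach (Growing A, b, h')" "rep s' h'" "levels s'" "loads s'" "synced s' h'"
      "budget t s' (w + 2 + 7 * (X - lo))" "\<forall>x\<in>{lo..<hi}. s' aQueue x = s aQueue x"
      "bij_betw (s' aQueue) {hi..<E} (A - s aQueue ` {X..<hi})"
      "centers h' = centers h" "\<forall>j\<in>s aQueue ` {X..<hi}. gball h' j = gball h j"
      "\<forall>j\<in>A - s aQueue ` {X..<hi}. min b n \<le> card (gball h' j)"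
      using 2(1) unfolding J_def X_def E_def by auto
    have Xhi: "X < hi" using 2(2) J(3) by (simp add: X_def)
    have split: "{X..<hi} = insert X {Suc X..<hi}" using Xhi by auto
    have notin: "i \<notin> s aQueue ` {Suc X..<hi}"
      using inj Xhi J(1) unfolding i_def by (auto dest!: inj_onD)
    have qX: "s' aQueue X = i" using J(1,11) Xhi by (simp add: i_def)
    have im: "i < m" using sub(2) J(1) Xhi unfolding i_def
      by (meson atLeastLessThan_iff imageI lessThan_iff subsetD)
    have "gball h' i = gball h i" using J(14) Xhi by (simp add: i_def)
    then have iA: "s' aHit i = 0 \<longleftrightarrow> i \<in> A"
      using J(9,13) im by (auto simp: synced_def A unhit_def)
    have J_next: "J t'' (store s'' vX 0 (Suc X)) h''"
      if "s'' vHi 0 = hi" "s'' vB 0 = b" "s'' vX 0 = X" "hi \<le> s'' vEnd 0"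
        "reach (Growing A, b, h'')" "rep s'' h''" "levels s''" "loads s''" "synced s'' h''"
        "budget t'' s'' (w + 9 + 7 * (X - lo))" "\<forall>x\<in>{lo..<hi}. s'' aQueue x = s aQueue x"
        "bij_betw (s'' aQueue) {hi..<s'' vEnd 0} (A - s aQueue ` {Suc X..<hi})"
        "centers h'' = centers h" "\<forall>j\<in>s aQueue ` {Suc X..<hi}. gball h'' j = gball h j"
        "\<forall>j\<in>A - s aQueue ` {Suc X..<hi}. min b n \<le> card (gball h'' j)" for t'' s'' h''
    proof -
      have "rep (store s'' vX 0 (Suc X)) h''" "levels (store s'' vX 0 (Suc X))"
        "loads (store s'' vX 0 (Suc X))" "synced (store s'' vX 0 (Suc X)) h''"
        using that(6-9) by (simp_all add: rep_def levels_def loads_def synced_def store_def)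
      moreover have "budget t'' (store s'' vX 0 (Suc X)) (w + 2 + 7 * (Suc X - lo))"
        using that(10) J(1)
        by (simp add: budget_def live_def unselected_def queued_def store_def Suc_diff_le)
      ultimately show ?thesis
        using that J(1) Xhi unfolding J_def by (simp add: store_def)
    qed
    show ?case
    proof (cases "i \<in> A")
      case False
      then have diff: "A - s aQueue ` {X..<hi} = A - s aQueue ` {Suc X..<hi}"
        unfolding split by (auto simp: i_def)
      have "J (t + 5) (store (store s' vI 0 i) vX 0 (Suc X)) h'"
      proof (rule J_next)
        show "rep (store s' vI 0 i) h'" "levels (store s' vI 0 i)"
          "loads (store s' vI 0 i)" "synced (store s' vI 0 i) h'"
          using J(6-9) by (simp_all add: rep_def levels_def loads_def synced_def store_def)
        show "budget (t + 5) (store s' vI 0 i) (w + 9 + 7 * (X - lo))"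
          using J(10) by (simp add: budget_def live_def unselected_def queued_def store_def)
      qed (use J diff in \<open>auto simp: store_def X_def E_def\<close>)
      moreover have "s' aHit i \<noteq> 0" using iA False by simp
      ultimately show ?thesis
        using qX Xhi by (simp add: store_def clock X_def)
    next
      case True
      define s1 where "s1 = s'(vI := (s' vI)(0 := i), aQueue := (s' aQueue)(E := i), vEnd := (s' vEnd)(0 := Suc E))"
      have s1: "s1 a = s' a" if "a \<notin> {vI, aQueue, vEnd}" for a using that by (simp add: s1_def)
      have inv1: "rep s1 h'" "levels s1" "loads s1" "synced s1 h'"
        using J(6-9) by (simp_all add: rep_def levels_def loads_def synced_def s1)
      have diff: "A - s aQueue ` {Suc X..<hi} = insert i (A - s aQueue ` {X..<hi})"
        using True notin unfolding split by (auto simp: i_def)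
      have bij: "bij_betw (s1 aQueue) {hi..<Suc E} (A - s aQueue ` {Suc X..<hi})"
      proof -
        have "bij_betw (s1 aQueue) {hi..<E} (A - s aQueue ` {X..<hi})"
          using J(12) by (rule bij_betw_cong[THEN iffD1, rotated]) (simp add: s1_def)
        moreover have "s1 aQueue E = i" by (simp add: s1_def)
        moreover have "i \<notin> A - s aQueue ` {X..<hi}" unfolding split by (simp add: i_def)
        moreover have "{hi..<Suc E} = insert E {hi..<E}" using J(2) by auto
        ultimately show ?thesis
          unfolding diff using notIn_Un_bij_betw[of E "{hi..<E}" "s1 aQueue"] by simp
      qed
      have "wp grow_ball (wp (Set_var vX (Add (Var vX) (Num 1)))
          (\<lambda>t'' s'' h''. J t'' s'' h'' \<and> hi - s'' vX 0 < hi - s' vX 0)) (t + 5) s1 h'"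
      proof (rule wp_grow_ball[where w = "w + 7 + 7 * (X - lo)", OF J(5) _ _ inv1])
        show "s1 vI 0 \<in> A" "s1 vB 0 = b" using True J(4) by (simp_all add: s1_def)
        show "budget (t + 5) s1 (w + 7 + 7 * (X - lo))"
          using J(10) by (simp add: budget_def live_def unselected_def queued_def s1)
        fix t2 s2 h2
        assume a: "reach (Growing A, b, h2)" "rep s2 h2" "levels s2" "loads s2" "synced s2 h2"
          "budget t2 s2 (w + 7 + 7 * (X - lo) + 1)" "min b n \<le> card (gball h2 (s1 vI 0))"
          "centers h2 = centers h'" "\<And>j. j \<noteq> s1 vI 0 \<Longrightarrow> gball h2 j = gball h' j"
          "\<And>a. a \<in> {vB, vLo, vHi, vX, vI, vEnd, aQueue} \<Longrightarrow> s2 a = s1 a"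
        have i1: "s1 vI 0 = i" "s1 vEnd 0 = Suc E" by (simp_all add: s1_def)
        have X2: "s2 vX 0 = X" using a(10)[of vX] by (simp add: s1 X_def)
        have "J (t2 + 1) (store s2 vX 0 (Suc X)) h2"
        proof (rule J_next)
          show "s2 vHi 0 = hi" "s2 vB 0 = b" "s2 vX 0 = X"
            using J(3,4) by (simp_all add: a(10) s1 X_def)
          show "hi \<le> s2 vEnd 0" using J(2) i1 by (simp add: a(10))
          show "budget (t2 + 1) s2 (w + 9 + 7 * (X - lo))" using a(6) by (simp add: budget_def)
          show "\<forall>x\<in>{lo..<hi}. s2 aQueue x = s aQueue x"
            using J(2,11) by (simp add: a(10) s1_def)
          show "bij_betw (s2 aQueue) {hi..<s2 vEnd 0} (A - s aQueue ` {Suc X..<hi})"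
            using bij i1 by (simp add: a(10))
          show "centers h2 = centers h" using a(8) J(13) by simp
          show "\<forall>j\<in>s aQueue ` {Suc X..<hi}. gball h2 j = gball h j"
          proof
            fix j assume j: "j \<in> s aQueue ` {Suc X..<hi}"
            then have "j \<noteq> i" using notin by auto
            then show "gball h2 j = gball h j" using a(9)[of j] i1 J(14) j unfolding split by auto
          qed
          show "\<forall>j\<in>A - s aQueue ` {Suc X..<hi}. min b n \<le> card (gball h2 j)"
          proof
            fix j assume "j \<in> A - s aQueue ` {Suc X..<hi}"
            then show "min b n \<le> card (gball h2 j)"
              using a(7) a(9)[of j] i1 J(15) unfolding diff by (cases "j = i") auto
          qed
        qed (use a in auto)
        then show "wp (Set_var vX (Add (Var vX) (Num 1)))
          (\<lambda>t'' s'' h''. J t'' s'' h'' \<and> hi - s'' vX 0 < hi - s' vX 0) t2 s2 h2"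
          using X2 Xhi by (simp add: X_def) (simp add: store_def)
      qed
      moreover have "s' aHit i = 0" using iA True by simp
      moreover have "store (store (store s' vI 0 i) aQueue E i) vEnd 0 (Suc E) = s1"
        by (simp add: s1_def store_def)
      ultimately show ?thesis
        using qX Xhi
        by (simp add: clock X_def[symmetric]) (simp add: store_def X_def[symmetric] E_def[symmetric] s1_def)
    qed
  next
    case (3 t s' h')
    then have X: "s' vX 0 = hi" unfolding J_def by auto
    have J: "hi \<le> s' vEnd 0" "s' vHi 0 = hi" "s' vB 0 = b"
      "reach (Growing A, b, h')" "rep s' h'" "levels s'" "loads s'" "synced s' h'"
      "budget t s' (w + 2 + 7 * (hi - lo))"
      "bij_betw (s' aQueue) {hi..<s' vEnd 0} A" "\<forall>j\<in>A. min b n \<le> card (gball h' j)"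
      using 3(1) X unfolding J_def by auto
    let ?s = "store (store s' vLo 0 hi) vHi 0 (s' vEnd 0)"
    have "Q (t + 3) ?s h'"
    proof (rule post[OF J(4)])
      show "rep ?s h'" "levels ?s" "loads ?s" "synced ?s h'"
        using J(5-8) by (simp_all add: rep_def levels_def loads_def synced_def store_def)
      have "card A = s' vEnd 0 - hi" using bij_betw_same_card[OF J(10)] by simp
      then show "?s vHi 0 = hi + card A" using J(1) by (simp add: store_def)
      show "budget (t + 3) ?s (w + 5 + 7 * (hi - lo))"
        using J(9) by (simp add: budget_def live_def unselected_def queued_def store_def)
    qed (use J in \<open>auto simp: store_def\<close>)
    then show ?case using J(2) by (simp add: clock) (simp add: store_def)
  qed
  then show ?thesis
    unfolding grow_phase_def by (simp add: hi_def lo_def) (simp add: store_def)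
qed

section \<open>The whole program and its running time\<close>

lemma wp_fill_queue:
  assumes "s vX 0 = 0" "s vM 0 = m"
    and post: "\<And>s'. (\<And>x. x < m \<Longrightarrow> s' aQueue x = x) \<Longrightarrow>
      (\<And>a. a \<notin> {vX, aQueue} \<Longrightarrow> s' a = s a) \<Longrightarrow> Q (t + 3 * m + 1) s' h"
  shows "wp fill_queue Q t s h"
  unfolding fill_queue_def
proof (rule wp_While_rule[where f = "\<lambda>s h. m - s vX 0" and
      I = "\<lambda>t' s' h'. h' = h \<and> s' vX 0 \<le> m \<and> t' = t + 3 * s' vX 0 \<and>
        (\<forall>x<s' vX 0. s' aQueue x = x) \<and> (\<forall>a. a \<notin> {vX, aQueue} \<longrightarrow> s' a = s a)"], goal_cases)
  case 1
  then show ?case using assms by simp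
next
  case (2 t' s' h')
  then have "s' vM 0 = m" using assms(2) by simp
  then show ?case using 2 by (auto simp: store_def less_Suc_eq)
next
  case (3 t' s' h')
  then have "s' vM 0 = m" using assms(2) by simp
  then have "s' vX 0 = m" using 3 by simp
  then show ?case using 3 post[of s'] by simp
qed

text \<open>Nodes are in bijection with incidences. This turns time per request into total ball
  size, to which the cost bound with exponent 1 applies.\<close>

lemma requests_eq_sizes:
  assumes "rep s h" "wf_hist h"
  shows "s vG 0 = (\<Sum>i<m. card (gball h i))"
proof -
  have "bij_betw (\<lambda>g. (s aBall g, s aVert g)) {1..s vG 0} (SIGMA i:{..<m}. gball h i)"
    unfolding bij_betw_def
  proof
    show "inj_on (\<lambda>g. (s aBall g, s aVert g)) {1..s vG 0}" using assms(1) by (simp add: rep_def)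
    show "(\<lambda>g. (s aBall g, s aVert g)) ` {1..s vG 0} = (SIGMA i:{..<m}. gball h i)"
      using node_bounds(1)[OF assms] by (force simp: rep_gball[OF assms(1)])
  qed
  then have "card {1..s vG 0} = card (SIGMA i:{..<m}. gball h i)" by (rule bij_betw_same_card)
  then show ?thesis by simp
qed

text \<open>An integer exceeds a nonnegative real exactly when it exceeds its floor, so comparing
  with \<open>Quota\<close> implements the real threshold.\<close>

lemma wp_select_loop:
  assumes reach: "reach (Selecting k, b, h)" and q: "s vQ 0 = nat \<lfloor>real k / 2 powr (p + 1)\<rfloor>"
    and rep: "rep s h" and lev: "levels s" and lo: "loads s" and syn: "synced s h"
    and bud: "budget t s w"
    and post: "\<And>t' s' h'. reach (Growing (unhit m h'), 2 * b, h') \<Longrightarrow>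
      real (card (unhit m h')) \<le> real k / 2 powr (p + 1) \<Longrightarrow> rep s' h' \<Longrightarrow> levels s' \<Longrightarrow> loads s' \<Longrightarrow>
      synced s' h' \<Longrightarrow> budget t' s' (w + 1) \<Longrightarrow> unhit m h' \<subseteq> unhit m h \<Longrightarrow>
      (\<And>a. a \<in> {vB, vLo, vHi, aQueue} \<Longrightarrow> s' a = s a) \<Longrightarrow> Q t' s' h'"
  shows "wp (While (Less (Var vQ) (Var vU)) select_center) Q t s h"
proof (rule wp_While_rule[where f = "\<lambda>s h. card (unhit m h)" and
      I = "\<lambda>t' s' h'. reach (Selecting k, b, h') \<and> rep s' h' \<and> levels s' \<and> loads s' \<and> synced s' h' \<and>
        budget t' s' w \<and> unhit m h' \<subseteq> unhit m h \<and>
        (\<forall>a\<in>{vB, vLo, vHi, vQ, aQueue}. s' a = s a)"], goal_cases)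
  case 1
  then show ?case using assms by simp
next
  case (2 t' s' h')
  then have I: "reach (Selecting k, b, h')" "rep s' h'" "levels s'" "loads s'" "synced s' h'"
    "budget t' s' w" "unhit m h' \<subseteq> unhit m h"
    and same: "\<And>a. a \<in> {vB, vLo, vHi, vQ, aQueue} \<Longrightarrow> s' a = s a" by auto
  have "nat \<lfloor>real k / 2 powr (p + 1)\<rfloor> < card (unhit m h')"
    using 2(2) q same[of vQ] unhit_count[OF I(4,5)] by simp
  then have gt: "real (card (unhit m h')) > real k / 2 powr (p + 1)" by linarith
  show ?case
  proof (rule wp_select_center[where w = "w + 1", OF I(1) gt I(2-5)], goal_cases)
    case 1
    then show ?case using I(6) by (simp add: budget_def)
  next
    case (2 t2 s2 h2)
    have "card (unhit m h2) < card (unhit m h')" using 2(7) by (simp add: psubset_card_mono)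
    moreover have "budget t2 s2 w" using 2(6) by (simp add: budget_def)
    moreover have "\<forall>a\<in>{vB, vLo, vHi, vQ, aQueue}. s2 a = s a" using 2(8) same by simp
    ultimately show ?case using 2(1-5,7) I(7) by blast
  qed
next
  case (3 t' s' h')
  then have I: "reach (Selecting k, b, h')" "rep s' h'" "levels s'" "loads s'" "synced s' h'"
    "budget t' s' w" "unhit m h' \<subseteq> unhit m h"
    and same: "\<And>a. a \<in> {vB, vLo, vHi, vQ, aQueue} \<Longrightarrow> s' a = s a" by auto
  have "card (unhit m h') \<le> nat \<lfloor>real k / 2 powr (p + 1)\<rfloor>"
    using 3(2) q same[of vQ] unhit_count[OF I(4,5)] by simp
  moreover have "0 \<le> real k / 2 powr (p + 1)" by simp
  ultimately have le: "real (card (unhit m h')) \<le> real k / 2 powr (p + 1)" by linarith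
  have "reach (Growing (unhit m h'), 2 * b, h')"
    using alg_step.double[OF le] I(1) by (meson rtranclp.rtrancl_into_rtrancl)
  then show ?case
    by (rule post[OF _ le I(2-5) _ I(7)]) (use I(6) same in \<open>auto simp: budget_def\<close>)
qed

text \<open>\<open>vLo\<close> counts the queue entries consumed. A phase advances it by
  \<open>card A\<close> and at least halves \<open>card A\<close>, hence
  \<open>vLo + 2 * card A\<close> never increases and stays at most \<open>3 * m\<close>. At 100
  units per consumed entry, which covers the overhead of a phase because \<open>A\<close> is
  nonempty, this yields \<open>300 * m\<close>.\<close>

lemma wp_main_loop:
  assumes reach: "reach (Growing A, b, h)" and b: "s vB 0 = b"
    and grown: "\<forall>i\<in>A. min b n \<le> card (gball h i)"
    and rep: "rep s h" and lev: "levels s" and lo: "loads s" and syn: "synced s h"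
    and q: "s vLo 0 \<le> s vHi 0" "bij_betw (s aQueue) {s vLo 0..<s vHi 0} A"
    and len: "s vLo 0 + 2 * card A \<le> 3 * m"
    and bud: "budget t s (w + 100 * s vLo 0)"
    and post: "\<And>t' s' h' b'. reach (Finished, b', h') \<Longrightarrow> rep s' h' \<Longrightarrow> budget t' s' (w + 300 * m + 1) \<Longrightarrow>
      Q t' s' h'"
  shows "wp (While (Neg (Equal (Var vU) (Num 0))) (seq [
       Set_var vQ (Quota (Var vU)),
       While (Less (Var vQ) (Var vU)) select_center,
       Set_var vB (Add (Var vB) (Var vB)),
       grow_phase])) Q t s h"
proof (rule wp_While_rule[where f = "\<lambda>s h. card (unhit m h)" and
      I = "\<lambda>t s h. \<exists>A. reach (Growing A, s vB 0, h) \<and> (\<forall>i\<in>A. min (s vB 0) n \<le> card (gball h i)) \<and>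
        rep s h \<and> levels s \<and> loads s \<and> synced s h \<and> s vLo 0 \<le> s vHi 0 \<and>
        bij_betw (s aQueue) {s vLo 0..<s vHi 0} A \<and> s vLo 0 + 2 * card A \<le> 3 * m \<and>
        budget t s (w + 100 * s vLo 0)"], goal_cases)
  case 1
  then show ?case using assms by blast
next
  case (2 t s h)
  then obtain A where I: "reach (Growing A, s vB 0, h)" "\<forall>i\<in>A. min (s vB 0) n \<le> card (gball h i)"
    "rep s h" "levels s" "loads s" "synced s h" "s vLo 0 \<le> s vHi 0"
    "bij_betw (s aQueue) {s vLo 0..<s vHi 0} A" "s vLo 0 + 2 * card A \<le> 3 * m"
    "budget t s (w + 100 * s vLo 0)" by blast
  let ?k = "card (unhit m h)"
  let ?lo = "s vLo 0"
  let ?hi = "s vHi 0"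
  have u: "s vU 0 = ?k" by (rule unhit_count[OF I(5,6)])
  then have k: "0 < ?k" using 2(2) by (simp add: card_gt_0_iff)
  then have ne: "unhit m h \<noteq> {}" by auto
  have A: "unhit m h \<subseteq> A" "A \<subseteq> {..<m}" using reach_inv[OF I(1), of 1] p_ge_1 by auto
  then have kA: "?k \<le> card A" by (meson card_mono finite_lessThan finite_subset)
  have cA: "card A = ?hi - ?lo" using bij_betw_same_card[OF I(8)] by simp
  have reach': "reach (Selecting ?k, s vB 0, h)"
    using alg_step.enter_loop[OF I(2) ne] I(1) by (meson rtranclp.rtrancl_into_rtrancl)
  let ?s = "store s vQ 0 (nat \<lfloor>real ?k / 2 powr (p + 1)\<rfloor>)"
  let ?P = "\<lambda>t s h. \<exists>A. reach (Growing A, s vB 0, h) \<and> (\<forall>i\<in>A. min (s vB 0) n \<le> card (gball h i)) \<and>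
        rep s h \<and> levels s \<and> loads s \<and> synced s h \<and> s vLo 0 \<le> s vHi 0 \<and>
        bij_betw (s aQueue) {s vLo 0..<s vHi 0} A \<and> s vLo 0 + 2 * card A \<le> 3 * m \<and>
        budget t s (w + 100 * s vLo 0)"
  have "wp (While (Less (Var vQ) (Var vU)) select_center)
    (wp (Seq (Set_var vB (Add (Var vB) (Var vB))) grow_phase)
      (\<lambda>t' s' h'. ?P t' s' h' \<and> card (unhit m h') < card (unhit m h))) (t + 2) ?s h"
  proof (rule wp_select_loop[where w = "w + 100 * ?lo + 2", OF reach'])
    show "?s vQ 0 = nat \<lfloor>real ?k / 2 powr (p + 1)\<rfloor>" by (simp add: store_def)
    show "rep ?s h" "levels ?s" "loads ?s" "synced ?s h"
      using I(3-6) by (simp_all add: rep_def levels_def loads_def synced_def store_def)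
    show "budget (t + 2) ?s (w + 100 * ?lo + 2)"
      using I(10) by (simp add: budget_def live_def unselected_def queued_def store_def)
    fix t1 s1 h1
    assume a: "reach (Growing (unhit m h1), 2 * s vB 0, h1)"
      "real (card (unhit m h1)) \<le> real ?k / 2 powr (p + 1)"
      "rep s1 h1" "levels s1" "loads s1" "synced s1 h1" "budget t1 s1 (w + 100 * ?lo + 2 + 1)"
      "unhit m h1 \<subseteq> unhit m h" "\<And>a. a \<in> {vB, vLo, vHi, aQueue} \<Longrightarrow> s1 a = ?s a"
    have same: "s1 a = s a" if "a \<in> {vB, vLo, vHi, aQueue}" for a
      using a(9)[OF that] that by (elim insertE) (simp_all add: store_def)
    let ?A = "unhit m h1"
    let ?s1 = "store s1 vB 0 (2 * s vB 0)"
    have half: "2 * card ?A \<le> ?k"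
    proof -
      have "real ?k / 2 powr (p + 1) \<le> real ?k / 2"
        using p_ge_1 powr_mono[of 1 "p + 1" 2] by (intro divide_left_mono) auto
      then show ?thesis using a(2) by linarith
    qed
    have lohi: "?s1 vLo 0 = ?lo" "?s1 vHi 0 = ?hi" "?s1 aQueue = s aQueue"
      by (simp_all add: store_def same)
    have "wp grow_phase (\<lambda>t' s' h'. ?P t' s' h' \<and> card (unhit m h') < card (unhit m h)) (t1 + 1) ?s1 h1"
    proof (rule wp_grow_phase[where w = "w + 100 * ?lo + 4", OF a(1)], unfold lohi)
      show "?s1 vB 0 = 2 * s vB 0" by (simp add: store_def)
      show "rep ?s1 h1" "levels ?s1" "loads ?s1" "synced ?s1 h1"
        using a(3-6) by (simp_all add: rep_def levels_def loads_def synced_def store_def)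
      show "budget (t1 + 1) ?s1 (w + 100 * ?lo + 4)"
        using a(7) by (simp add: budget_def live_def unselected_def queued_def store_def)
      show "inj_on (s aQueue) {?lo..<?hi}" "?A \<subseteq> s aQueue ` {?lo..<?hi}"
        "s aQueue ` {?lo..<?hi} \<subseteq> {..<m}"
        using I(8) A a(8) by (auto simp: bij_betw_def)
      fix t2 s2 h2
      assume c: "reach (Growing ?A, 2 * s vB 0, h2)" "rep s2 h2" "levels s2" "loads s2" "synced s2 h2"
        "s2 vB 0 = 2 * s vB 0" "\<forall>i\<in>?A. min (2 * s vB 0) n \<le> card (gball h2 i)"
        "s2 vLo 0 = ?hi" "s2 vHi 0 = ?hi + card ?A"
        "bij_betw (s2 aQueue) {s2 vLo 0..<s2 vHi 0} ?A"
        "budget t2 s2 (w + 100 * ?lo + 4 + 5 + 7 * (?hi - ?lo))"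
      have "unhit m h2 \<subseteq> ?A" using reach_inv[OF c(1), of 1] p_ge_1 by auto
      then have "card (unhit m h2) \<le> card ?A" by (simp add: card_mono)
      then have "card (unhit m h2) < ?k" using half k by linarith
      moreover have "?hi + 2 * card ?A \<le> 3 * m" using half kA cA I(7,9) by linarith
      moreover have "budget t2 s2 (w + 100 * ?hi)"
      proof -
        have "1 \<le> ?hi - ?lo" using k kA cA by linarith
        then have "100 * ?lo + 4 + 5 + 7 * (?hi - ?lo) \<le> 100 * ?hi" using I(7) by linarith
        then show ?thesis using c(11) unfolding budget_def by linarith
      qed
      ultimately show "?P t2 s2 h2 \<and> card (unhit m h2) < card (unhit m h)"
        using c by (intro conjI exI[of _ ?A]) simp_all
    qed (use I(7) in auto)
    then show "wp (Seq (Set_var vB (Add (Var vB) (Var vB))) grow_phase)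
      (\<lambda>t' s' h'. ?P t' s' h' \<and> card (unhit m h') < card (unhit m h)) t1 s1 h1"
      using same[of vB] by (simp add: mult_2)
  qed
  then show ?case by (simp add: u)
next
  case (3 t s h)
  then obtain A where I: "reach (Growing A, s vB 0, h)" "\<forall>i\<in>A. min (s vB 0) n \<le> card (gball h i)"
    "rep s h" "loads s" "synced s h" "s vLo 0 + 2 * card A \<le> 3 * m"
    "budget t s (w + 100 * s vLo 0)" by blast
  have "unhit m h = {}" using unhit_count[OF I(4,5)] 3(2) by (simp add: card_eq_0_iff)
  then have "reach (Finished, s vB 0, h)"
    using alg_step.exit_loop[OF I(2)] I(1) by (meson rtranclp.rtrancl_into_rtrancl)
  moreover have "budget (t + 1) s (w + 300 * m + 1)"
    using I(6,7) unfolding budget_def by linarith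
  ultimately show ?case using post I(3) by blast
qed

text \<open>Of the \<open>310 * m\<close> units, the main loop takes \<open>300 * m\<close>, filling
  the queue 3 and the first growing phase 7 per ball.\<close>

lemma wp_program:
  "wp program (\<lambda>t s h. \<exists>b. reach (Finished, b, h) \<and>
     t \<le> 200 * (\<Sum>i<m. card (gball h i)) + 310 * m + 11) 0 (input_memory n m) []"
proof -
  let ?Q = "\<lambda>t s h. \<exists>b. reach (Finished, b, h) \<and>
     t \<le> 200 * (\<Sum>i<m. card (gball h i)) + 310 * m + 11"
  let ?loop = "While (Neg (Equal (Var vU) (Num 0))) (seq [
       Set_var vQ (Quota (Var vU)),
       While (Less (Var vQ) (Var vU)) select_center,
       Set_var vB (Add (Var vB) (Var vB)),
       grow_phase])"
  let ?s = "store (store (store (input_memory n m) vB 0 b0) vU 0 m) vHi 0 m"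
  have unhit0: "unhit m [] = {..<m}" by (auto simp: unhit_def)
  have reach: "reach (Growing {..<m}, b0, [])" by (simp add: init_config_def)
  have "wp fill_queue (wp (Seq grow_phase ?loop) ?Q) 3 ?s []"
  proof (rule wp_fill_queue)
    show "?s vX 0 = 0" "?s vM 0 = m" by (simp_all add: store_def input_memory_def)
    fix s1
    assume q1: "\<And>x. x < m \<Longrightarrow> s1 aQueue x = x" and s1: "\<And>a. a \<notin> {vX, aQueue} \<Longrightarrow> s1 a = ?s a"
    have z: "s1 a = (\<lambda>_. 0)" if "a \<notin> {vN, vM, vB, vU, vHi, vX, aQueue}" for a
      using that by (simp add: s1 store_def input_memory_def)
    have sc: "s1 vN 0 = n" "s1 vM 0 = m" "s1 vB 0 = b0" "s1 vU 0 = m" "s1 vHi 0 = m" "s1 vLo 0 = 0"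
      by (simp_all add: s1 store_def input_memory_def)
    have "wp grow_phase (wp ?loop ?Q) (3 + 3 * m + 1) s1 []"
    proof (rule wp_grow_phase[where s = s1 and w = "4 + 3 * m", OF reach sc(3)], unfold sc)
      show "rep s1 []" using sc(1,2) by (simp add: rep_def z)
      show "levels s1" by (simp add: levels_def z)
      show "loads s1" using sc(4) by (simp add: loads_def z)
      show "synced s1 []" by (simp add: synced_def z unhit0)
      show "inj_on (s1 aQueue) {0..<m}" "{..<m} \<subseteq> s1 aQueue ` {0..<m}"
        "s1 aQueue ` {0..<m} \<subseteq> {..<m}"
        using q1 by (auto simp: inj_on_def image_def)
      show "budget (3 + 3 * m + 1) s1 (4 + 3 * m)"
        by (simp add: budget_def live_def unselected_def queued_def z)
      fix t2 s2 h2
      assume c: "reach (Growing {..<m}, b0, h2)" "rep s2 h2" "levels s2" "loads s2" "synced s2 h2"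
        "s2 vB 0 = b0" "\<forall>i\<in>{..<m}. min b0 n \<le> card (gball h2 i)"
        "s2 vLo 0 = m" "s2 vHi 0 = m + card {..<m}"
        "bij_betw (s2 aQueue) {s2 vLo 0..<s2 vHi 0} {..<m}"
        "budget t2 s2 (4 + 3 * m + 5 + 7 * (m - 0))"
      show "wp ?loop ?Q t2 s2 h2"
      proof (rule wp_main_loop[where w = "10 * m + 9", OF c(1,6,7,2-5) _ c(10)])
        show "s2 vLo 0 \<le> s2 vHi 0" "s2 vLo 0 + 2 * card {..<m} \<le> 3 * m" using c(8,9) by simp_all
        show "budget t2 s2 (10 * m + 9 + 100 * s2 vLo 0)" using c(11) by (simp add: budget_def)
        fix t' s' h' b'
        assume d: "reach (Finished, b', h')" "rep s' h'" "budget t' s' (10 * m + 9 + 300 * m + 1)"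
        have "wf_hist h'" using reach_inv[OF d(1), of 1] p_ge_1 by simp
        then have "s' vG 0 = (\<Sum>i<m. card (gball h' i))" by (rule requests_eq_sizes[OF d(2)])
        then show "\<exists>b. reach (Finished, b, h') \<and> t' \<le> 200 * (\<Sum>i<m. card (gball h' i)) + 310 * m + 11"
          using d(1,3) unfolding budget_def by (intro exI[of _ b']) simp
      qed
    qed (simp_all add: unhit0)
    then show "wp (Seq grow_phase ?loop) ?Q (3 + 3 * m + 1) s1 []" by simp
  qed
  then show ?thesis
    unfolding program_def by (simp add: numeral_3_eq_3) (simp add: store_def input_memory_def)
qed

text \<open>There are at most \<open>2 * (2 powr (p + 2) + 1) * (m * n / r)\<close> requests at 200
  units each, which gives the factor 400. The rest, \<open>310 * m + 11\<close>, is absorbed because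
  \<open>m \<le> m * n / r\<close> and \<open>1 \<le> r\<close>, which gives 321.\<close>

lemma program_correct:
  "\<exists>s h b T. exec p n r adv program (input_memory n m, []) T (s, h) \<and> reach (Finished, b, h) \<and>
     real T \<le> (400 * (2 powr (p + 2) + 1) + 321) * (r + real m * real n / r)"
proof -
  obtain T s h b where e: "exec p n r adv program (input_memory n m, []) T (s, h)"
    and reach: "reach (Finished, b, h)"
    and T: "T \<le> 200 * (\<Sum>i<m. card (gball h i)) + 310 * m + 11"
    using wp_program unfolding wp_def by auto
  have I: "config_inv 1 (Finished, b, h)" using reach_inv[OF reach, of 1] p_ge_1 by simp
  define N where "N = real m * real n / r"
  have N: "0 \<le> N" using r_ge_1 by (simp add: N_def)
  have "(\<Sum>i<m. real (card (gball h i))) \<le> 2 * (2 powr (p + 2) + 1) * N"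
    using cost_bound[OF I] r_ge_1 by (simp add: ball_cost_def N_def)
  moreover have "real m \<le> N"
  proof -
    have "real m * 1 \<le> real m * (real n / r)"
      using r_le_n r_ge_1 by (intro mult_left_mono) auto
    then show ?thesis by (simp add: N_def)
  qed
  moreover have "real T \<le> 200 * (\<Sum>i<m. real (card (gball h i))) + 310 * real m + 11"
  proof -
    have "real T \<le> real (200 * (\<Sum>i<m. card (gball h i)) + 310 * m + 11)" using T of_nat_le_iff by blast
    then show ?thesis by simp
  qed
  ultimately have "real T \<le> 400 * (2 powr (p + 2) + 1) * N + 310 * N + 11 * r"
    using r_ge_1 by linarith
  also have "\<dots> \<le> (400 * (2 powr (p + 2) + 1) + 321) * N + (400 * (2 powr (p + 2) + 1) + 321) * r"
    using N r_ge_1 by (intro add_mono) (simp_all add: distrib_right)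
  finally have "real T \<le> (400 * (2 powr (p + 2) + 1) + 321) * (r + N)"
    by (simp add: distrib_left add.commute)
  then show ?thesis using e reach unfolding N_def by blast
qed

end

theorem theorem2p1:
  fixes p :: real
  assumes "p \<ge> 1"
  shows
    "(\<exists>C>0. \<forall>(n::nat) (m::nat) (r::real) adv.
        1 \<le> r \<and> r \<le> real n \<and> valid_adversary n m adv \<longrightarrow>
        (\<nexists>c. c 0 = init_config p n m r \<and> (\<forall>j::nat. alg_step p n m adv (c j) (c (Suc j)))) \<and>
        (\<forall>c. (alg_step p n m adv)\<^sup>*\<^sup>* (init_config p n m r) c \<and> (\<nexists>c'. alg_step p n m adv c c') \<longrightarrow>
           (\<exists>b h. c = (Finished, b, h) \<and>
              centers h \<subseteq> {..<n} \<and>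
              real (card (centers h)) \<le> r \<and>
              (\<forall>i<m. gball h i \<inter> centers h \<noteq> {}) \<and>
              total_cost p m h \<le> C * (real m * cost_fun p (real n / r)))))
     \<and>
     (\<exists>prog. \<exists>C>0. \<forall>(n::nat) (m::nat) (r::real) adv.
        1 \<le> r \<and> r \<le> real n \<and> valid_adversary n m adv \<longrightarrow>
        (\<exists>s h b T.
           exec p n r adv prog (input_memory n m, []) T (s, h) \<and>
           (alg_step p n m adv)\<^sup>*\<^sup>* (init_config p n m r) (Finished, b, h) \<and>
           real T \<le> C * (r + real m * real n / r)))"
proof -
  have H: "hitting p n m r adv" if "1 \<le> r \<and> r \<le> real n \<and> valid_adversary n m adv" for n m r adv
    using assms that by unfold_locales auto
  define C\<^sub>1 where "C\<^sub>1 = 2 * (2 powr (p + 2) + 1) powr p"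
  define C\<^sub>2 where "C\<^sub>2 = 400 * (2 powr (p + 2) + 1) + (321 :: real)"
  have pos: "0 < 2 powr (p + 2) + (1 :: real)" by (simp add: add_pos_pos)
  then have "0 < C\<^sub>2" unfolding C\<^sub>2_def by (intro add_pos_pos mult_pos_pos) simp_all
  moreover have "0 < C\<^sub>1" using pos by (simp add: C\<^sub>1_def)
  moreover note hitting.terminates[OF H] hitting.stuck_correct[OF H, folded C\<^sub>1_def]
    hitting.program_correct[OF H, folded C\<^sub>2_def]
  ultimately show ?thesis
    by (intro conjI[OF exI[of _ C\<^sub>1] exI[of _ program]] exI[of _ C\<^sub>2]) blast+
qed

end
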